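(* Let $X=(X(n))_{n\in\mathbb{N}_0}$ be a simple random walk in $\mathbb{Z}^2$ perturbed on the set $A=\{(0,0)\}$ with $X(0)=(0,0)$ a.s.; that is, $X$ is a Markov chain on $\mathbb{Z}^2$ which, from any point of $\mathbb{Z}^2\setminus\{(0,0)\}$, moves to each of its four nearest neighbors in $\mathbb{Z}^2$ with probability $1/4$, and whose jump from $(0,0)$ has the distribution of $X(1)$. Assume that, for a constant $a>0$, $$\mathbb{P}\{|X(1)|>t\}\ \sim\ \frac{a}{\log\log t},\quad t\to\infty.$$ Then $$\liminf_{n\to\infty}\mathbb{P}\Big\{\max_{1\leq k\leq n}|X(k)|>n\Big\}>0.$$ In particular, the sequence of distributions of the processes $(n^{-1}X(\lfloor nt\rfloor))_{t\geq 0}$, $n\in\mathbb{N}$, is not tight in any of the Skorokhod topologies ($J_1$, $J_2$, $M_1$, $M_2$) on $D([0,\infty),\mathbb{R}^2)$.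
   Context: $\mathbb{N}_0=\{0,1,2,\dots\}$. $D([0,\infty),\mathbb{R}^2)$ is the Skorokhod space of càdlàg functions from $[0,\infty)$ to $\mathbb{R}^2$; the Skorokhod topologies are the four topologies $J_1$, $J_2$, $M_1$, $M_2$ introduced by Skorokhod (1956). The relation $f(t)\sim g(t)$ as $t\to\infty$ means $f(t)/g(t)\to 1$. *)

theory Defs
  imports "HOL-Probability.Probability" "HOL-Library.Landau_Symbols"
begin

section \<open>The space of cadlag functions and the Skorokhod topologies\<close>

text \<open>Functions on \<open>[0,\<infinity>)\<close> are represented by total functions that are \<open>undefined\<close> on the
  negative half-line, so that equality of functions is equality on \<open>[0,\<infinity>)\<close>.\<close>

definition cadlag :: "(real \<Rightarrow> 'a::real_normed_vector) set" where
  "cadlag = {x \<in> extensional {0..}.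
     (\<forall>t\<ge>0. (x \<longlongrightarrow> x t) (at_right t)) \<and> (\<forall>t>0. \<exists>l. (x \<longlongrightarrow> l) (at_left t))}"

definition left_limit :: "(real \<Rightarrow> 'a::real_normed_vector) \<Rightarrow> real \<Rightarrow> 'a" where
  "left_limit x t = (if t \<le> 0 then x 0 else Lim (at_left t) x)"

definition completed_graph :: "real \<Rightarrow> (real \<Rightarrow> 'a::real_normed_vector) \<Rightarrow> ('a \<times> real) set" where
  "completed_graph T x = {(z, t). t \<in> {0..T} \<and> z \<in> closed_segment (left_limit x t) (x t)}"

text \<open>The order on the completed graph in which it is traversed from left to right, each jump
  segment being traversed from the left limit to the value.\<close>

definition graph_le :: "(real \<Rightarrow> 'a::real_normed_vector) \<Rightarrow> 'a \<times> real \<Rightarrow> 'a \<times> real \<Rightarrow> bool" where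
  "graph_le x p q \<longleftrightarrow> snd p < snd q \<or>
     snd p = snd q \<and> norm (fst p - left_limit x (snd p)) \<le> norm (fst q - left_limit x (snd p))"

definition parametric_rep ::
  "real \<Rightarrow> (real \<Rightarrow> 'a::real_normed_vector) \<Rightarrow> (real \<Rightarrow> 'a \<times> real) \<Rightarrow> bool" where
  "parametric_rep T x g \<longleftrightarrow> continuous_on {0..1} g \<and> g ` {0..1} = completed_graph T x \<and>
     (\<forall>s\<in>{0..1}. \<forall>s'\<in>{0..1}. s \<le> s' \<longrightarrow> graph_le x (g s) (g s'))"

text \<open>Skorokhod's four modes of convergence of a sequence \<open>xs\<close> to \<open>x\<close> on a compact interval
  \<open>[0,T]\<close>. In the first one, an increasing bijection of \<open>[0,T]\<close> is automatically a
  homeomorphism; in the second one, the bijections need not be continuous or monotone.\<close>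

definition J1_conv ::
  "real \<Rightarrow> (nat \<Rightarrow> real \<Rightarrow> 'a::real_normed_vector) \<Rightarrow> (real \<Rightarrow> 'a) \<Rightarrow> bool" where
  "J1_conv T xs x \<longleftrightarrow> (\<exists>\<phi>::nat \<Rightarrow> real \<Rightarrow> real.
     (\<forall>n. strict_mono_on {0..T} (\<phi> n) \<and> bij_betw (\<phi> n) {0..T} {0..T}) \<and>
     uniform_limit {0..T} \<phi> (\<lambda>t. t) sequentially \<and>
     uniform_limit {0..T} (\<lambda>n t. xs n t - x (\<phi> n t)) (\<lambda>t. 0) sequentially)"

definition J2_conv ::
  "real \<Rightarrow> (nat \<Rightarrow> real \<Rightarrow> 'a::real_normed_vector) \<Rightarrow> (real \<Rightarrow> 'a) \<Rightarrow> bool" where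
  "J2_conv T xs x \<longleftrightarrow> (\<exists>\<phi>::nat \<Rightarrow> real \<Rightarrow> real.
     (\<forall>n. bij_betw (\<phi> n) {0..T} {0..T}) \<and>
     uniform_limit {0..T} \<phi> (\<lambda>t. t) sequentially \<and>
     uniform_limit {0..T} (\<lambda>n t. xs n t - x (\<phi> n t)) (\<lambda>t. 0) sequentially)"

definition M1_conv ::
  "real \<Rightarrow> (nat \<Rightarrow> real \<Rightarrow> 'a::real_normed_vector) \<Rightarrow> (real \<Rightarrow> 'a) \<Rightarrow> bool" where
  "M1_conv T xs x \<longleftrightarrow> (\<exists>gs g. (\<forall>n. parametric_rep T (xs n) (gs n)) \<and> parametric_rep T x g \<and>
     uniform_limit {0..1} gs g sequentially)"

text \<open>Convergence of the completed graphs in the Hausdorff distance.\<close>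

definition M2_conv ::
  "real \<Rightarrow> (nat \<Rightarrow> real \<Rightarrow> 'a::real_normed_vector) \<Rightarrow> (real \<Rightarrow> 'a) \<Rightarrow> bool" where
  "M2_conv T xs x \<longleftrightarrow> (\<forall>\<epsilon>>0. \<forall>\<^sub>F n in sequentially.
     (\<forall>p\<in>completed_graph T x. \<exists>q\<in>completed_graph T (xs n). dist p q < \<epsilon>) \<and>
     (\<forall>q\<in>completed_graph T (xs n). \<exists>p\<in>completed_graph T x. dist p q < \<epsilon>))"

text \<open>Passage from compact intervals to \<open>[0,\<infinity>)\<close>: a sequence converges to \<open>x\<close> iff its restrictions
  to \<open>[0,T]\<close> converge for every continuity point \<open>T\<close> of \<open>x\<close>. All four modes of convergence on
  \<open>[0,\<infinity>)\<close> come from a metric, so the topology is the one whose open sets are the sequentially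
  open ones.\<close>

definition halfline_conv ::
  "(real \<Rightarrow> (nat \<Rightarrow> real \<Rightarrow> 'a::real_normed_vector) \<Rightarrow> (real \<Rightarrow> 'a) \<Rightarrow> bool) \<Rightarrow>
   (nat \<Rightarrow> real \<Rightarrow> 'a) \<Rightarrow> (real \<Rightarrow> 'a) \<Rightarrow> bool" where
  "halfline_conv conv xs x \<longleftrightarrow> (\<forall>T>0. isCont x T \<longrightarrow> conv T xs x)"

definition cadlag_topology ::
  "(real \<Rightarrow> (nat \<Rightarrow> real \<Rightarrow> 'a::real_normed_vector) \<Rightarrow> (real \<Rightarrow> 'a) \<Rightarrow> bool) \<Rightarrow>
   (real \<Rightarrow> 'a) topology" where
  "cadlag_topology conv = topology (\<lambda>U. U \<subseteq> cadlag \<and>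
     (\<forall>x\<in>U. \<forall>xs. (\<forall>n. xs n \<in> cadlag) \<and> halfline_conv conv xs x \<longrightarrow>
        (\<forall>\<^sub>F n in sequentially. xs n \<in> U)))"

lemma openin_cadlag_topology:
  "openin (cadlag_topology conv) U \<longleftrightarrow> U \<subseteq> cadlag \<and>
     (\<forall>x\<in>U. \<forall>xs. (\<forall>n. xs n \<in> cadlag) \<and> halfline_conv conv xs x \<longrightarrow>
        (\<forall>\<^sub>F n in sequentially. xs n \<in> U))"
proof -
  let ?P = "\<lambda>U. U \<subseteq> cadlag \<and>
     (\<forall>x\<in>U. \<forall>xs. (\<forall>n. xs n \<in> cadlag) \<and> halfline_conv conv xs x \<longrightarrow>
        (\<forall>\<^sub>F n in sequentially. xs n \<in> U))"
  have "istopology ?P"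
    unfolding istopology_def
  proof (intro conjI allI impI)
    fix S T assume S: "?P S" and T: "?P T"
    show "S \<inter> T \<subseteq> cadlag" using S by blast
    show "\<forall>x\<in>S \<inter> T. \<forall>xs. (\<forall>n. xs n \<in> cadlag) \<and> halfline_conv conv xs x \<longrightarrow>
        (\<forall>\<^sub>F n in sequentially. xs n \<in> S \<inter> T)"
      using S T by (auto simp: eventually_conj_iff)
  next
    fix \<K> assume K: "\<forall>S\<in>\<K>. ?P S"
    then show "\<Union>\<K> \<subseteq> cadlag" by blast
    show "\<forall>x\<in>\<Union>\<K>. \<forall>xs. (\<forall>n. xs n \<in> cadlag) \<and> halfline_conv conv xs x \<longrightarrow>
        (\<forall>\<^sub>F n in sequentially. xs n \<in> \<Union>\<K>)"
    proof (intro ballI allI impI)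
      fix x xs assume "x \<in> \<Union>\<K>" and c: "(\<forall>n. xs n \<in> cadlag) \<and> halfline_conv conv xs x"
      then obtain S where "S \<in> \<K>" "x \<in> S" by blast
      with K c have "\<forall>\<^sub>F n in sequentially. xs n \<in> S" by blast
      then show "\<forall>\<^sub>F n in sequentially. xs n \<in> \<Union>\<K>"
        by (rule eventually_mono) (use \<open>S \<in> \<K>\<close> in blast)
    qed
  qed
  then show ?thesis
    by (simp add: cadlag_topology_def topology_inverse')
qed

lemma topspace_cadlag_topology [simp]: "topspace (cadlag_topology conv) = cadlag"
proof -
  have "openin (cadlag_topology conv) cadlag"
    by (simp add: openin_cadlag_topology)
  then show ?thesis
    by (meson openin_cadlag_topology openin_subset openin_topspace subset_antisym)
qed

definition J1_topology :: "(real \<Rightarrow> 'a::real_normed_vector) topology" where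
  "J1_topology = cadlag_topology J1_conv"

definition J2_topology :: "(real \<Rightarrow> 'a::real_normed_vector) topology" where
  "J2_topology = cadlag_topology J2_conv"

definition M1_topology :: "(real \<Rightarrow> 'a::real_normed_vector) topology" where
  "M1_topology = cadlag_topology M1_conv"

definition M2_topology :: "(real \<Rightarrow> 'a::real_normed_vector) topology" where
  "M2_topology = cadlag_topology M2_conv"


section \<open>Tightness\<close>

definition borel_of :: "'a topology \<Rightarrow> 'a measure" where
  "borel_of T = sigma (topspace T) {U. openin T U}"

definition tight_family :: "'a topology \<Rightarrow> 'i set \<Rightarrow> ('i \<Rightarrow> 'a measure) \<Rightarrow> bool" where
  "tight_family T I \<mu> \<longleftrightarrow>
     (\<forall>\<epsilon>>0. \<exists>K. compactin T K \<and> (\<forall>i\<in>I. measure (\<mu> i) K \<ge> 1 - \<epsilon>))"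


section \<open>Markov chains and the perturbed random walk\<close>

definition markov_chain ::
  "'w measure \<Rightarrow> (nat \<Rightarrow> 'w \<Rightarrow> 's) \<Rightarrow> ('s \<Rightarrow> 's \<Rightarrow> real) \<Rightarrow> bool" where
  "markov_chain M X p \<longleftrightarrow> (\<forall>n. X n \<in> measurable M (count_space UNIV)) \<and>
     (\<forall>n xs y. \<P>(\<omega> in M. \<forall>k\<le>n. X k \<omega> = xs k) > 0 \<longrightarrow>
        \<P>(\<omega> in M. X (Suc n) \<omega> = y \<bar> \<forall>k\<le>n. X k \<omega> = xs k) = p (xs n) y)"

definition nearest_neighbours :: "int^2 \<Rightarrow> (int^2) set" where
  "nearest_neighbours x = (\<Union>i. {x + axis i 1, x - axis i 1})"

text \<open>The jump from the origin has the law of \<open>X 1\<close>, which is not prescribed.\<close>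

definition perturbed_transition ::
  "'w measure \<Rightarrow> (nat \<Rightarrow> 'w \<Rightarrow> int^2) \<Rightarrow> int^2 \<Rightarrow> int^2 \<Rightarrow> real" where
  "perturbed_transition M X x y =
     (if x = 0 then \<P>(\<omega> in M. X 1 \<omega> = y)
      else if y \<in> nearest_neighbours x then 1/4 else 0)"

definition perturbed_walk :: "'w measure \<Rightarrow> (nat \<Rightarrow> 'w \<Rightarrow> int^2) \<Rightarrow> bool" where
  "perturbed_walk M X \<longleftrightarrow>
     markov_chain M X (perturbed_transition M X) \<and> (AE \<omega> in M. X 0 \<omega> = 0)"

definition real_point :: "int^2 \<Rightarrow> real^2" where
  "real_point z = (\<chi> i. real_of_int (z $ i))"

definition scaled_path :: "nat \<Rightarrow> (nat \<Rightarrow> 'w \<Rightarrow> int^2) \<Rightarrow> 'w \<Rightarrow> real \<Rightarrow> real^2" where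
  "scaled_path n X \<omega> = (\<lambda>t\<in>{0..}. (1 / real n) *\<^sub>R real_point (X (nat \<lfloor>real n * t\<rfloor>) \<omega>))"

end

theory Submission
  imports Defs "HOL-Real_Asymp.Real_Asymp"
begin

text \<open>A walk that leaves the origin by a jump exceeding \<open>n\<^sup>2\<close> cannot return within \<open>n\<close> steps, so the events
  that the walk is at the origin at time \<open>k < n\<close> and makes such a jump are disjoint, and the maximum
  exceeds \<open>n\<^sup>2\<close> with probability at least \<open>P(|X(1)| > n\<^sup>2)\<close> times the expected number of visits to the
  origin before time \<open>n\<close>. By the last-exit decomposition the latter is at least \<open>n\<close> divided by the sum
  over \<open>j < n\<close> of the probabilities that an excursion lasts longer than \<open>j\<close>. Such an excursion
  starts with a jump beyond \<open>R = exp (sqrt (ln n))\<close>, which has probability about \<open>2 a / ln ln n\<close>, or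
  starts within distance \<open>R\<close> and still misses the origin for a time \<open>j \<ge> sqrt n\<close>, which has
  probability of order \<open>ln R / ln n\<close>, by comparison of the Green functions of the planar walk
  at its starting point and at the origin. As \<open>P(|X(1)| > n\<^sup>2)\<close> is about \<open>a / ln ln n\<close>, the
  product stays away from \<open>0\<close>.

  Having \<open>n\<^sup>2\<close> instead of \<open>n\<close> in this bound defeats tightness: in each of the four topologies the
  paths in a compact set are uniformly bounded on \<open>[0,1]\<close>.\<close>

section \<open>Hitting the origin by the planar simple random walk\<close>

lemma sum_nearest_neighbours:
  fixes g :: "int^2 \<Rightarrow> 'a::comm_monoid_add"
  shows "(\<Sum>y\<in>nearest_neighbours x. g y) =
    g (x + axis 1 1) + g (x - axis 1 1) + (g (x + axis 2 1) + g (x - axis 2 1))"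
proof -
  have "nearest_neighbours x = {x + axis 1 1, x - axis 1 1, x + axis 2 1, x - axis 2 1}"
    by (auto simp: nearest_neighbours_def UNIV_2)
  then show ?thesis
    by (simp add: vec_eq_iff axis_def exhaust_2 forall_2 add.assoc)
qed

lemma finite_nearest_neighbours [simp]: "finite (nearest_neighbours x)"
  by (simp add: nearest_neighbours_def)

lemma card_nearest_neighbours [simp]: "card (nearest_neighbours x) = 4"
  by (simp only: card_eq_sum sum_nearest_neighbours)

text \<open>For the simple random walk started at \<open>x\<close>, the numbers \<open>plane_kernel k x\<close>, \<open>hit_at k x\<close> and
  \<open>avoid k x\<close> below are the probabilities that the walk is at the origin at time \<open>k\<close>, that it visits
  the origin for the first time at time \<open>k\<close>, and that it does not visit the origin up to time \<open>k\<close>.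
  Time \<open>0\<close> counts as a visit.\<close>

primrec line_kernel :: "nat \<Rightarrow> int \<Rightarrow> real" where
  "line_kernel 0 u = of_bool (u = 0)"
| "line_kernel (Suc k) u = (line_kernel k (u - 1) + line_kernel k (u + 1)) / 2"

primrec plane_kernel :: "nat \<Rightarrow> int^2 \<Rightarrow> real" where
  "plane_kernel 0 x = of_bool (x = 0)"
| "plane_kernel (Suc k) x = (\<Sum>y\<in>nearest_neighbours x. plane_kernel k y) / 4"

primrec hit_at :: "nat \<Rightarrow> int^2 \<Rightarrow> real" where
  "hit_at 0 x = of_bool (x = 0)"
| "hit_at (Suc k) x = (if x = 0 then 0 else (\<Sum>y\<in>nearest_neighbours x. hit_at k y) / 4)"

primrec avoid :: "nat \<Rightarrow> int^2 \<Rightarrow> real" where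
  "avoid 0 x = of_bool (x \<noteq> 0)"
| "avoid (Suc k) x = (if x = 0 then 0 else (\<Sum>y\<in>nearest_neighbours x. avoid k y) / 4)"

text \<open>In the rotated coordinates \<open>x\<^sub>1 + x\<^sub>2\<close> and \<open>x\<^sub>1 - x\<^sub>2\<close> the planar walk consists of two
  independent walks on the line.\<close>

lemma plane_kernel_eq: "plane_kernel k x = line_kernel k (x$1 + x$2) * line_kernel k (x$1 - x$2)"
proof (induction k arbitrary: x)
  case 0
  show ?case by (auto simp: vec_eq_iff forall_2)
next
  case (Suc k)
  let ?u = "x$1 + x$2" and ?v = "x$1 - x$2"
  have "plane_kernel (Suc k) x =
    (line_kernel k (?u + 1) * line_kernel k (?v + 1) + line_kernel k (?u - 1) * line_kernel k (?v - 1)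
     + (line_kernel k (?u + 1) * line_kernel k (?v - 1) + line_kernel k (?u - 1) * line_kernel k (?v + 1))) / 4"
    by (simp add: sum_nearest_neighbours Suc axis_def algebra_simps)
  also have "\<dots> = line_kernel (Suc k) ?u * line_kernel (Suc k) ?v"
    by (simp add: field_simps)
  finally show ?case .
qed

section \<open>The kernel on the line: binomial formula and bounds\<close>

lemma line_kernel_eq_0: "\<bar>u\<bar> > int k \<Longrightarrow> line_kernel k u = 0"
  by (induction k arbitrary: u) auto

lemma line_kernel_uminus: "line_kernel k (- u) = line_kernel k u"
proof (induction k arbitrary: u)
  case (Suc k)
  have "line_kernel k (- u - 1) = line_kernel k (u + 1)" "line_kernel k (- u + 1) = line_kernel k (u - 1)"
    using Suc[of "u + 1"] Suc[of "u - 1"] by simp_all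
  then show ?case by simp
qed auto

text \<open>A path of \<open>k\<close> steps, \<open>i\<close> of them upwards, ends at
  \<open>2 * i - k\<close>, and the recursion of the kernel is Pascal's rule. Both sides vanish for
  \<open>i > k\<close>.\<close>

lemma line_kernel_binomial: "line_kernel k (2 * int i - int k) = real (k choose i) / 2 ^ k"
proof (induction k arbitrary: i)
  case 0
  show ?case by (cases i) auto
next
  case (Suc k)
  show ?case
  proof (cases i)
    case 0
    have "line_kernel k (- int k) = real (k choose 0) / 2 ^ k" using Suc[of 0] by simp
    moreover have "line_kernel k (- int k - 2) = 0" by (rule line_kernel_eq_0) auto
    ultimately show ?thesis using 0 by (simp add: algebra_simps)
  next
    case (Suc i')
    then show ?thesis using Suc.IH[of i] Suc.IH[of i'] 
      by (simp add: algebra_simps add_divide_distrib)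
  qed
qed

lemma line_kernel_even: "line_kernel (2 * k) (2 * int j) = real (2 * k choose (k + j)) / 4 ^ k"
  using line_kernel_binomial[of "2 * k" "k + j"] by (simp add: power_mult)

lemma line_kernel_0: "line_kernel (2 * k) 0 = real (2 * k choose k) / 4 ^ k"
  using line_kernel_even[of k 0] by simp

text \<open>Passing from \<open>j\<close> to \<open>j + 1\<close> multiplies the coefficient by
  \<open>(k - j) / (k + j + 1)\<close>, hence loses at most the fraction
  \<open>(2 * j + 1) / k\<close> of the central coefficient. The odd numbers below
  \<open>2 * j\<close> add up to \<open>j ^ 2\<close>.\<close>

lemma central_binomial_drop:
  assumes "k > 0"
  shows "real (2 * k choose (k + j)) \<ge> real (2 * k choose k) * (1 - real j ^ 2 / real k)"
proof (induction j)
  case 0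
  show ?case by simp
next
  case (Suc j)
  let ?C = "\<lambda>i. real (2 * k choose (k + i))"
  have le: "?C j \<le> ?C 0"
    using binomial_maximum'[of k "k + j"] by simp
  have "?C (Suc j) \<ge> ?C j - ?C 0 * ((2 * real j + 1) / real k)"
  proof (cases "j \<le> k")
    case True
    have "Suc (k + j) * (2 * k choose Suc (k + j)) = (2 * k - (k + j)) * (2 * k choose (k + j))"
      by (metis binomial_absorb_comp binomial_absorption)
    then have "real (Suc (k + j)) * ?C (Suc j) = (real k - real j) * ?C j"
      using True by (metis add_Suc_right add_diff_cancel_left mult_2 of_nat_diff of_nat_mult)
    then have "?C (Suc j) = ?C j - ?C j * ((2 * real j + 1) / (real k + real j + 1))"
      by (simp add: field_simps)
    moreover have "?C j * ((2 * real j + 1) / (real k + real j + 1)) \<le> ?C 0 * ((2 * real j + 1) / real k)"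
      using assms le by (intro mult_mono frac_le) auto
    ultimately show ?thesis by linarith
  next
    case False
    then show ?thesis by (simp add: binomial_eq_0)
  qed
  moreover have "?C 0 * (1 - real (Suc j) ^ 2 / real k) =
     ?C 0 * (1 - real j ^ 2 / real k) - ?C 0 * ((2 * real j + 1) / real k)"
    by (simp add: power2_eq_square algebra_simps diff_divide_distrib add_divide_distrib)
  ultimately show ?case using Suc by simp
qed

lemma line_kernel_lower:
  assumes "k > 0"
  shows "line_kernel (2 * k) (2 * j) \<ge> line_kernel (2 * k) 0 * (1 - real_of_int j ^ 2 / real k)"
proof -
  have "line_kernel (2 * k) (2 * j) = line_kernel (2 * k) (2 * int (nat \<bar>j\<bar>))"
    using line_kernel_uminus[of "2 * k" "2 * j"] by (cases "j \<ge> 0") auto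
  then have "line_kernel (2 * k) (2 * j) = real (2 * k choose (k + nat \<bar>j\<bar>)) / 4 ^ k"
    by (simp only: line_kernel_even)
  moreover have "real (nat \<bar>j\<bar>) ^ 2 = real_of_int j ^ 2" by simp
  ultimately show ?thesis
    using divide_right_mono[OF central_binomial_drop[OF assms, of "nat \<bar>j\<bar>"], of "4 ^ k"]
    by (simp add: line_kernel_0)
qed

text \<open>The ratio of successive central binomial coefficients, divided by \<open>4\<close>,
  obtained from absorption and symmetry; it drives the two inductions that stand in for Stirling's
  formula.\<close>

lemma line_kernel_0_Suc:
  "line_kernel (2 * Suc k) 0 = line_kernel (2 * k) 0 * ((2 * real k + 1) / (2 * real k + 2))"
proof -
  have "Suc k * (Suc (2 * k) choose Suc k) = Suc (2 * k) * (2 * k choose k)"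
    using Suc_times_binomial_eq[of "2 * k" k] by simp
  moreover have "(2 * Suc k choose Suc k) = 2 * (Suc (2 * k) choose Suc k)"
    using binomial_symmetric[of k "Suc (2 * k)"] by simp
  ultimately have "real (Suc k) * real (2 * Suc k choose Suc k) = 2 * (real (Suc (2 * k)) * real (2 * k choose k))"
    by (metis (no_types, opaque_lifting) mult.left_commute of_nat_mult of_nat_numeral)
  then have "real (2 * Suc k choose Suc k) = 2 * (real (Suc (2 * k)) * real (2 * k choose k)) / real (Suc k)"
    by (simp add: field_simps del: binomial_Suc_Suc)
  then show ?thesis unfolding line_kernel_0
    by (simp add: divide_simps del: binomial_Suc_Suc) (simp add: algebra_simps)
qed

text \<open>The induction closes because
  \<open>(2 * k + 1) * (2 * k + 3) \<le> (2 * k + 2) ^ 2\<close>.\<close>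

lemma line_kernel_0_upper: "(line_kernel (2 * k) 0)\<^sup>2 \<le> 1 / (2 * real k + 1)"
proof (induction k)
  case (Suc k)
  have "(line_kernel (2 * Suc k) 0)\<^sup>2 \<le> 1 / (2 * real k + 1) * ((2 * real k + 1) / (2 * real k + 2))\<^sup>2"
    unfolding line_kernel_0_Suc power_mult_distrib by (intro mult_right_mono Suc) auto
  also have "\<dots> = (2 * real k + 1) / (2 * real k + 2)\<^sup>2"
    by (simp add: power2_eq_square power_divide)
  also have "\<dots> \<le> 1 / (2 * real (Suc k) + 1)"
  proof -
    have "(2 * real k + 1) * (2 * real (Suc k) + 1) \<le> (2 * real k + 2)\<^sup>2"
      by (simp add: power2_eq_square algebra_simps)
    moreover have "0 < (2 * real k + 2)\<^sup>2" "0 < 2 * real (Suc k) + 1" by auto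
    ultimately show ?thesis by (simp only: pos_divide_le_eq times_divide_eq_left pos_le_divide_eq mult_1)
  qed
  finally show ?case .
qed auto

text \<open>Starts with equality at \<open>k = 1\<close> and closes because
  \<open>4 * k * (k + 1) \<le> (2 * k + 1) ^ 2\<close>. With the upper bound, the squared kernel,
  which is the return probability of the planar walk, has order \<open>1 / k\<close>.\<close>

lemma line_kernel_0_lower: "k > 0 \<Longrightarrow> (line_kernel (2 * k) 0)\<^sup>2 \<ge> 1 / (4 * real k)"
proof (induction k)
  case (Suc k)
  show ?case
  proof (cases "k = 0")
    case True
    then show ?thesis by (simp add: line_kernel_0 power2_eq_square numeral_eq_Suc)
  next
    case False
    have "1 / (4 * real (Suc k)) \<le> 1 / (4 * real k) * ((2 * real k + 1) / (2 * real k + 2))\<^sup>2"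
    proof -
      have "4 * real k * real (Suc k) \<le> (2 * real k + 1)\<^sup>2"
        by (simp add: power2_eq_square algebra_simps)
      then have "4 * real k * real (Suc k) * (1 / (16 * real k * (real (Suc k))\<^sup>2)) \<le>
          (2 * real k + 1)\<^sup>2 * (1 / (16 * real k * (real (Suc k))\<^sup>2))"
        by (rule mult_right_mono) simp
      moreover have "4 * real k * real (Suc k) * (1 / (16 * real k * (real (Suc k))\<^sup>2)) = 1 / (4 * real (Suc k))"
        using False by (simp add: power2_eq_square del: of_nat_Suc)
      moreover have "(2 * real k + 2) = 2 * real (Suc k)" by simp
      then have "1 / (4 * real k) * ((2 * real k + 1) / (2 * real k + 2))\<^sup>2 =
          (2 * real k + 1)\<^sup>2 * (1 / (16 * real k * (real (Suc k))\<^sup>2))"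
        by (simp add: power_divide power_mult_distrib del: of_nat_Suc)
      ultimately show ?thesis by simp
    qed
    also have "\<dots> \<le> (line_kernel (2 * Suc k) 0)\<^sup>2"
      unfolding line_kernel_0_Suc power_mult_distrib using False Suc by (intro mult_right_mono) auto
    finally show ?thesis .
  qed
qed auto

lemma plane_kernel_nonneg: "plane_kernel k x \<ge> 0"
  by (induction k arbitrary: x) (auto intro!: sum_nonneg)

lemma plane_kernel_0_eq: "plane_kernel (2 * k) 0 = (line_kernel (2 * k) 0)\<^sup>2"
  by (simp add: plane_kernel_eq power2_eq_square)

lemma norm_real_point: "(norm (real_point x))\<^sup>2 = (real_of_int (x$1))\<^sup>2 + (real_of_int (x$2))\<^sup>2"
  by (simp add: norm_vec_def L2_set_def real_point_def sum_2)

text \<open>In the rotated coordinates \<open>2 * j\<close> and \<open>2 * l\<close> the squared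
  norm is \<open>2 * (j ^ 2 + l ^ 2)\<close>, so the bound is the product of two line bounds,
  weakened by \<open>(1 - s) * (1 - t) \<ge> 1 - (s + t)\<close>. Parity matters because an even
  number of steps connects the origin only with points of even coordinate sum.\<close>

lemma plane_kernel_lower:
  assumes "k > 0" and ev: "even (x$1 + x$2)"
  shows "plane_kernel (2 * k) x \<ge> plane_kernel (2 * k) 0 * (1 - (norm (real_point x))\<^sup>2 / (2 * real k))"
proof (cases "(norm (real_point x))\<^sup>2 / (2 * real k) \<le> 1")
  \<comment> \<open>Here the lower bound is not positive; in the other case both factors
    \<open>1 - s\<close> and \<open>1 - t\<close> are nonnegative, so that the line bounds can be
    multiplied.\<close>
  case False
  then have "plane_kernel (2 * k) 0 * (1 - (norm (real_point x))\<^sup>2 / (2 * real k)) \<le> 0"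
    by (intro mult_nonneg_nonpos plane_kernel_nonneg) auto
  then show ?thesis using plane_kernel_nonneg[of "2 * k" x] by linarith
next
  case True
  obtain j where j: "x$1 + x$2 = 2 * j" using ev by blast
  obtain l where l: "x$1 - x$2 = 2 * l" using ev by (metis dvdE even_add even_diff)
  define s t where "s = real_of_int j ^ 2 / real k" and "t = real_of_int l ^ 2 / real k"
  have x: "x$1 = j + l" "x$2 = j - l" using j l by auto
  have st: "(norm (real_point x))\<^sup>2 / (2 * real k) = s + t"
    unfolding norm_real_point x s_def t_def by (simp add: power2_eq_square algebra_simps add_divide_distrib)
  have st0: "s \<ge> 0" "t \<ge> 0" by (auto simp: s_def t_def)
  have c: "line_kernel (2 * k) 0 \<ge> 0" by (simp add: line_kernel_0)
  have "plane_kernel (2 * k) 0 * (1 - (s + t)) \<le> (line_kernel (2 * k) 0)\<^sup>2 * ((1 - s) * (1 - t))"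
    unfolding plane_kernel_0_eq using st0 by (intro mult_left_mono) (auto simp: algebra_simps)
  also have "\<dots> = (line_kernel (2 * k) 0 * (1 - s)) * (line_kernel (2 * k) 0 * (1 - t))"
    by (simp add: power2_eq_square)
  also have "\<dots> \<le> line_kernel (2 * k) (2 * j) * line_kernel (2 * k) (2 * l)"
  proof (intro mult_mono)
    show "line_kernel (2 * k) 0 * (1 - s) \<le> line_kernel (2 * k) (2 * j)"
      "line_kernel (2 * k) 0 * (1 - t) \<le> line_kernel (2 * k) (2 * l)"
      unfolding s_def t_def by (rule line_kernel_lower[OF assms(1)])+
    have "0 \<le> line_kernel (2 * k) 0 * (1 - s)" "0 \<le> line_kernel (2 * k) 0 * (1 - t)"
      using c st0 True st by auto
    then show "0 \<le> line_kernel (2 * k) 0 * (1 - t)" "0 \<le> line_kernel (2 * k) (2 * j)"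
      using line_kernel_lower[OF assms(1), of j] unfolding s_def by linarith+
  qed
  also have "\<dots> = plane_kernel (2 * k) x" by (simp add: plane_kernel_eq j l)
  finally show ?thesis by (simp add: st)
qed

section \<open>First visits to the origin\<close>

lemma hit_at_nonneg: "hit_at k x \<ge> 0"
  by (induction k arbitrary: x) (auto intro!: sum_nonneg)

lemma sum_hit_at: "(\<Sum>k\<le>m. hit_at k x) = 1 - avoid m x"
proof (induction m arbitrary: x)
  case (Suc m)
  show ?case
  proof (cases "x = 0")
    case True
    have "(\<Sum>k\<le>Suc m. hit_at k 0) = hit_at 0 0 + (\<Sum>k\<le>m. hit_at (Suc k) 0)"
      by (rule sum.atMost_Suc_shift)
    then show ?thesis using True by simp
  next
    case False
    have "(\<Sum>k\<le>Suc m. hit_at k x) = (\<Sum>k\<le>m. (\<Sum>y\<in>nearest_neighbours x. hit_at k y) / 4)"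
      using False by (subst sum.atMost_Suc_shift) simp
    also have "\<dots> = (\<Sum>y\<in>nearest_neighbours x. \<Sum>k\<le>m. hit_at k y) / 4"
      by (subst sum.swap) (simp add: sum_divide_distrib)
    also have "\<dots> = 1 - avoid (Suc m) x"
      using False by (simp add: Suc sum_nearest_neighbours field_simps)
    finally show ?thesis .
  qed
qed auto

text \<open>Decomposition at the first visit to the origin; the induction conditions on the first
  step. From \<open>x = 0\<close> only the term \<open>k = 0\<close> survives.\<close>

lemma plane_kernel_renewal: "plane_kernel m x = (\<Sum>k\<le>m. hit_at k x * plane_kernel (m - k) 0)"
proof (induction m arbitrary: x)
  case (Suc m)
  have *: "(\<Sum>k\<le>Suc m. hit_at k x * plane_kernel (Suc m - k) 0) =
      hit_at 0 x * plane_kernel (Suc m) 0 + (\<Sum>k\<le>m. hit_at (Suc k) x * plane_kernel (m - k) 0)"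
    by (subst sum.atMost_Suc_shift) simp
  show ?case
  proof (cases "x = 0")
    case False
    have "plane_kernel (Suc m) x = (\<Sum>y\<in>nearest_neighbours x. \<Sum>k\<le>m. hit_at k y * plane_kernel (m - k) 0) / 4"
      by (simp add: Suc)
    also have "\<dots> = (\<Sum>k\<le>m. (\<Sum>y\<in>nearest_neighbours x. hit_at k y) / 4 * plane_kernel (m - k) 0)"
      by (subst sum.swap) (simp add: sum_divide_distrib sum_distrib_right)
    finally show ?thesis unfolding * using False by simp
  qed (use * in simp)
qed auto

lemma avoid_antimono: "k \<le> l \<Longrightarrow> avoid l x \<le> avoid k x"
proof -
  assume "k \<le> l"
  then have "(\<Sum>i\<le>k. hit_at i x) \<le> (\<Sum>i\<le>l. hit_at i x)"
    by (intro sum_mono2 hit_at_nonneg) auto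
  then show ?thesis by (simp add: sum_hit_at)
qed

text \<open>Summing the first-visit decomposition over time compares the truncated Green functions
  at \<open>x\<close> and at the origin: what remains of the time after the first visit is at most
  \<open>m\<close>. A Green function at \<open>x\<close> close to that at the origin therefore
  forces a small \<open>avoid m x\<close>.\<close>

lemma avoid_green:
  "(\<Sum>k\<le>m. plane_kernel k x) \<le> (1 - avoid m x) * (\<Sum>k\<le>m. plane_kernel k 0)"
proof -
  have "(\<Sum>k\<le>m. plane_kernel k x) = (\<Sum>i\<le>m. \<Sum>k\<le>i. hit_at k x * plane_kernel (i - k) 0)"
    by (rule sum.cong) (auto intro: plane_kernel_renewal)
  also have "\<dots> = (\<Sum>(i, k)\<in>(SIGMA i:{..m}. {..i}). hit_at k x * plane_kernel (i - k) 0)"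
    by (simp add: sum.Sigma)
  \<comment> \<open>The pair of current time and first-visit time becomes first-visit time
    \<open>k\<close> and time \<open>j\<close> elapsed since.\<close>
  also have "\<dots> = (\<Sum>(k, j)\<in>(SIGMA k:{..m}. {..m - k}). hit_at k x * plane_kernel j 0)"
    by (rule sum.reindex_bij_witness[of _ "\<lambda>(k, j). (k + j, k)" "\<lambda>(i, k). (k, i - k)"]) auto
  also have "\<dots> = (\<Sum>k\<le>m. hit_at k x * (\<Sum>j\<le>m - k. plane_kernel j 0))"
    by (simp add: sum.Sigma sum_distrib_left)
  also have "\<dots> \<le> (\<Sum>k\<le>m. hit_at k x * (\<Sum>j\<le>m. plane_kernel j 0))"
    by (intro sum_mono mult_left_mono sum_mono2 hit_at_nonneg plane_kernel_nonneg) auto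
  also have "\<dots> = (1 - avoid m x) * (\<Sum>k\<le>m. plane_kernel k 0)"
    by (simp add: sum_hit_at flip: sum_distrib_right)
  finally show ?thesis .
qed

lemma line_kernel_odd: "odd (int k + u) \<Longrightarrow> line_kernel k u = 0"
  by (induction k arbitrary: u) auto

lemma sum_plane_kernel_0: "(\<Sum>k\<le>2 * m. plane_kernel k 0) = (\<Sum>k\<le>m. plane_kernel (2 * k) 0)"
proof (induction m)
  case (Suc m)
  have "plane_kernel (Suc (2 * m)) 0 = 0"
    unfolding plane_kernel_eq by (simp add: line_kernel_odd del: line_kernel.simps)
  then show ?case using Suc by (simp del: plane_kernel.simps)
qed simp

lemma sum_plane_kernel_even: "(\<Sum>k\<le>m. plane_kernel (2 * k) x) \<le> (\<Sum>k\<le>2 * m. plane_kernel k x)"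
proof (induction m)
  case (Suc m)
  then show ?case using plane_kernel_nonneg[of "Suc (2 * m)" x] by (simp del: plane_kernel.simps)
qed simp

section \<open>Logarithmic growth of the Green function\<close>

lemma green_0_lower: "ln (real m) / 4 \<le> (\<Sum>k\<le>m. plane_kernel (2 * k) 0)" if "m > 0"
proof -
  have "ln (real m) \<le> harm m"
    using ln_le_harm[of m] that by (smt (verit) ln_mono of_nat_0_less_iff)
  moreover have "(\<Sum>k=1..m. 1 / (4 * real k)) = harm m / 4"
    by (simp add: harm_def sum_divide_distrib divide_simps mult.commute)
  ultimately have "ln (real m) / 4 \<le> (\<Sum>k=1..m. 1 / (4 * real k))"
    by simp
  also have "\<dots> \<le> (\<Sum>k=1..m. plane_kernel (2 * k) 0)"
    unfolding plane_kernel_0_eq by (intro sum_mono line_kernel_0_lower) auto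
  also have "\<dots> \<le> (\<Sum>k\<le>m. plane_kernel (2 * k) 0)"
    by (intro sum_mono2 plane_kernel_nonneg) auto
  finally show ?thesis .
qed

lemma green_0_upper: "(\<Sum>k\<le>m. plane_kernel (2 * k) 0) \<le> 2 + ln (real m)" if "m > 0"
proof -
  have "(\<Sum>k\<le>m. plane_kernel (2 * k) 0) \<le> (\<Sum>k\<le>m. 1 / (2 * real k + 1))"
    unfolding plane_kernel_0_eq by (intro sum_mono line_kernel_0_upper)
  also have "\<dots> = 1 + (\<Sum>k=1..m. 1 / (2 * real k + 1))"
    by (simp add: atMost_atLeast0 sum.atLeast_Suc_atMost)
  also have "\<dots> \<le> 1 + (\<Sum>k=1..m. inverse (real k))"
    by (intro add_mono sum_mono) (auto simp: inverse_eq_divide divide_simps)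
  \<comment> \<open>\<open>harm m - ln m\<close> decreases in \<open>m\<close> from its value
    \<open>1\<close> at \<open>m = 1\<close>.\<close>
  also have "\<dots> \<le> 2 + ln (real m)"
    using euler_mascheroni_sequence_decreasing[of 1 m] that by (simp add: harm_def)
  finally show ?thesis .
qed

text \<open>The times up to \<open>k0\<close> are given up, at a cost \<open>G0\<close> of order at
  most \<open>ln k0\<close>; beyond \<open>k0\<close> the kernel at \<open>x\<close> is at least
  \<open>1 - \<eta>\<close> times that at the origin. Since the whole sum \<open>G\<close> is at
  least of order \<open>ln m\<close>, the comparison of Green functions leaves the bound
  \<open>\<eta> + G0 / G\<close>.\<close>

lemma avoid_even_le:
  assumes ev: "even (x$1 + x$2)" and R: "norm (real_point x) \<le> R"
    and k0: "0 < k0" "k0 \<le> m" and m: "1 < m"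
  shows "avoid (2 * m) x \<le> R\<^sup>2 / (2 * real k0) + 4 * (2 + ln (real k0)) / ln (real m)"
proof -
  define g where "g = (\<lambda>k. plane_kernel (2 * k) 0)"
  define G0 G where "G0 = (\<Sum>k\<le>k0. g k)" and "G = (\<Sum>k\<le>m. g k)"
  define \<eta> where "\<eta> = R\<^sup>2 / (2 * real k0)"
  have g: "g k \<ge> 0" for k by (simp add: g_def plane_kernel_nonneg)
  have lnm: "ln (real m) > 0" using m by simp
  have G: "ln (real m) / 4 \<le> G" unfolding G_def g_def using m by (intro green_0_lower) auto
  have G0: "G0 \<le> 2 + ln (real k0)" unfolding G0_def g_def using k0 by (intro green_0_upper) auto
  have G0': "G0 \<ge> 0" unfolding G0_def by (intro sum_nonneg g)
  have "{..m} = {..k0} \<union> {k0<..m}" using k0 by auto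
  then have split: "G = G0 + (\<Sum>k\<in>{k0<..m}. g k)"
    unfolding G_def G0_def by (simp only:) (rule sum.union_disjoint; auto)
  have "(1 - \<eta>) * (\<Sum>k\<in>{k0<..m}. g k) = (\<Sum>k\<in>{k0<..m}. g k * (1 - \<eta>))"
    by (simp add: sum_distrib_left mult.commute)
  also have "\<dots> \<le> (\<Sum>k\<in>{k0<..m}. plane_kernel (2 * k) x)"
  proof (rule sum_mono)
    fix k assume k: "k \<in> {k0<..m}"
    have "(norm (real_point x))\<^sup>2 / (2 * real k) \<le> \<eta>"
      unfolding \<eta>_def using k k0 R by (intro frac_le power_mono) auto
    then have "g k * (1 - \<eta>) \<le> g k * (1 - (norm (real_point x))\<^sup>2 / (2 * real k))"
      by (intro mult_left_mono g) auto
    also have "\<dots> \<le> plane_kernel (2 * k) x"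
      unfolding g_def using k by (intro plane_kernel_lower ev) auto
    finally show "g k * (1 - \<eta>) \<le> plane_kernel (2 * k) x" .
  qed
  also have "\<dots> \<le> (\<Sum>k\<le>m. plane_kernel (2 * k) x)"
    by (intro sum_mono2 plane_kernel_nonneg) auto
  also have "\<dots> \<le> (1 - avoid (2 * m) x) * G"
    unfolding G_def g_def sum_plane_kernel_0[symmetric]
    using sum_plane_kernel_even avoid_green by (rule order_trans)
  finally have "(1 - \<eta>) * (G - G0) \<le> (1 - avoid (2 * m) x) * G" using split by simp
  moreover have "0 \<le> \<eta> * G0" using G0' by (simp add: \<eta>_def)
  ultimately have "avoid (2 * m) x * G \<le> \<eta> * G + G0" by (simp add: algebra_simps)
  then have "avoid (2 * m) x \<le> \<eta> + G0 / G"
    using G lnm by (simp add: field_simps)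
  also have "G0 / G \<le> (2 + ln (real k0)) / (ln (real m) / 4)"
    using G0 G0' G lnm by (intro frac_le) auto
  finally show ?thesis by (simp add: \<eta>_def mult.commute)
qed

section \<open>Survival from an arbitrary starting point\<close>

lemma real_point_add: "real_point (x + y) = real_point x + real_point y"
  and real_point_diff: "real_point (x - y) = real_point x - real_point y"
  by (simp_all add: real_point_def vec_eq_iff)

lemma norm_real_point_axis [simp]: "norm (real_point (axis i 1)) = 1"
proof -
  have "real_point (axis i 1) = axis i 1"
    by (simp add: real_point_def vec_eq_iff axis_def)
  then show ?thesis by simp
qed

lemma norm_nearest_neighbours:
  assumes "y \<in> nearest_neighbours x"
  shows "norm (real_point y) \<le> norm (real_point x) + 1" "norm (real_point x) \<le> norm (real_point y) + 1"
proof -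
  obtain i where "y = x + axis i 1 \<or> y = x - axis i 1"
    using assms by (auto simp: nearest_neighbours_def)
  then have "norm (real_point y - real_point x) = 1"
    by (auto simp: real_point_add real_point_diff)
  then show "norm (real_point y) \<le> norm (real_point x) + 1" "norm (real_point x) \<le> norm (real_point y) + 1"
    by (smt (verit) norm_triangle_sub norm_minus_commute)+
qed

text \<open>From a point of odd coordinate sum the walk steps to one of even sum, at distance at
  most \<open>R + 1\<close>; this accounts for the extra unit of time and for \<open>R + 1\<close>
  in the bound.\<close>

lemma avoid_le:
  assumes R: "norm (real_point x) \<le> R"
    and k0: "0 < k0" "k0 \<le> m" and m: "1 < m"
  shows "avoid (Suc (2 * m)) x \<le> (R + 1)\<^sup>2 / (2 * real k0) + 4 * (2 + ln (real k0)) / ln (real m)"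
    (is "_ \<le> ?B")
proof (cases "even (x$1 + x$2)")
  case True
  have "avoid (Suc (2 * m)) x \<le> avoid (2 * m) x" by (rule avoid_antimono) simp
  also have "\<dots> \<le> ?B" using R by (intro avoid_even_le True k0 m) auto
  finally show ?thesis .
next
  case False
  have "avoid (2 * m) y \<le> ?B" if y: "y \<in> nearest_neighbours x" for y
  proof (rule avoid_even_le[OF _ _ k0 m])
    show "norm (real_point y) \<le> R + 1" using norm_nearest_neighbours(1)[OF y] R by simp
    show "even (y$1 + y$2)" using y False
      by (auto simp: nearest_neighbours_def axis_def exhaust_2 UNIV_2)
  qed
  then have "(\<Sum>y\<in>nearest_neighbours x. avoid (2 * m) y) \<le> (\<Sum>y\<in>nearest_neighbours x. ?B)"
    by (rule sum_mono)
  moreover have "x \<noteq> 0" using False by auto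
  moreover have "(\<Sum>y\<in>nearest_neighbours x. ?B) = 4 * ?B" by (simp only: sum_constant card_nearest_neighbours of_nat_numeral)
  ultimately show ?thesis by simp
qed

text \<open>One step changes the norm by at most \<open>1\<close>, so the origin is out of reach.
  This is what makes a jump beyond the time horizon irreversible.\<close>

lemma avoid_eq_1: "norm (real_point x) > real k \<Longrightarrow> avoid k x = 1"
proof (induction k arbitrary: x)
  case 0
  have "real_point 0 = 0" by (simp add: real_point_def vec_eq_iff)
  with 0 have "x \<noteq> 0" by auto
  then show ?case by simp
next
  case (Suc k)
  have "real_point 0 = 0" by (simp add: real_point_def vec_eq_iff)
  with Suc.prems have "x \<noteq> 0" by auto
  moreover have "avoid k y = 1" if "y \<in> nearest_neighbours x" for y
    using norm_nearest_neighbours(2)[OF that] Suc.prems by (intro Suc.IH) simp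
  then have "(\<Sum>y\<in>nearest_neighbours x. avoid k y) = (\<Sum>y\<in>nearest_neighbours x. 1)"
    by (rule sum.cong[OF refl])
  then have "(\<Sum>y\<in>nearest_neighbours x. avoid k y) = 4"
    by (simp only: sum_nearest_neighbours)
  ultimately show ?case by simp
qed

section \<open>Excursions of the perturbed walk\<close>

lemma disjoint_family_on_less:
  fixes A :: "'a::linorder \<Rightarrow> 'b set"
  assumes "\<And>k l. k \<in> S \<Longrightarrow> l \<in> S \<Longrightarrow> k < l \<Longrightarrow> A k \<inter> A l = {}"
  shows "disjoint_family_on A S"
  unfolding disjoint_family_on_def using assms by (metis Int_commute linorder_neqE)

locale perturbed_random_walk = prob_space M for M :: "'w measure" +
  fixes X :: "nat \<Rightarrow> 'w \<Rightarrow> int^2"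
  assumes walk: "perturbed_walk M X"
begin

section \<open>Histories and the Markov property\<close>

lemma X_measurable [measurable]: "X n \<in> measurable M (count_space UNIV)"
  using walk by (simp add: perturbed_walk_def markov_chain_def)

lemma markov:
  assumes "\<P>(\<omega> in M. \<forall>k\<le>n. X k \<omega> = xs k) > 0"
  shows "\<P>(\<omega> in M. X (Suc n) \<omega> = y \<bar> \<forall>k\<le>n. X k \<omega> = xs k) = perturbed_transition M X (xs n) y"
proof -
  from walk have "\<forall>n xs y. \<P>(\<omega> in M. \<forall>k\<le>n. X k \<omega> = xs k) > 0 \<longrightarrow>
        \<P>(\<omega> in M. X (Suc n) \<omega> = y \<bar> \<forall>k\<le>n. X k \<omega> = xs k) = perturbed_transition M X (xs n) y"
    unfolding perturbed_walk_def markov_chain_def by (elim conjE)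
  from this[rule_format, OF assms] show ?thesis .
qed

lemma norm_measurable [measurable]: "(\<lambda>\<omega>. norm (real_point (X n \<omega>))) \<in> borel_measurable M"
  by (rule measurable_compose[OF X_measurable]) simp

text \<open>The past is encoded as a list over a countable type, so that every predicate on it is an
  event.\<close>

definition hist :: "nat \<Rightarrow> 'w \<Rightarrow> (int^2) list" where
  "hist k \<omega> = map (\<lambda>i. X i \<omega>) [0..<Suc k]"

lemma hist_eq_iff: "hist k \<omega> = l \<longleftrightarrow> length l = Suc k \<and> (\<forall>i\<le>k. X i \<omega> = l ! i)"
  unfolding hist_def list_eq_iff_nth_eq by (auto simp: less_Suc_eq_le simp del: upt_Suc)

lemma hist_nth: "i \<le> k \<Longrightarrow> hist k \<omega> ! i = X i \<omega>"
  by (simp add: hist_def less_Suc_eq_le del: upt_Suc)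

lemma hist_measurable [measurable]: "hist k \<in> measurable M (count_space UNIV)"
proof (subst measurable_count_space_eq2_countable, intro conjI ballI)
  fix l :: "(int^2) list"
  have "hist k -` {l} \<inter> space M = {\<omega>\<in>space M. length l = Suc k \<and> (\<forall>i\<le>k. X i \<omega> = l ! i)}"
    unfolding vimage_def Int_def mem_Collect_eq singleton_iff hist_eq_iff by blast
  also have "\<dots> \<in> sets M" by measurable
  finally show "hist k -` {l} \<inter> space M \<in> sets M" .
qed auto

lemma hist_pred [measurable]: "Measurable.pred M (\<lambda>\<omega>. R (hist k \<omega>))"
  by (rule measurable_compose[OF hist_measurable]) simp

text \<open>An identity with a constant factor may be checked on each cell of a countable partition;
  \<open>to_nat\<close> turns the cells into the terms of a series.\<close>

lemma prob_countable_split: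
  fixes h :: "'w \<Rightarrow> 'b::countable"
  assumes [measurable]: "h \<in> measurable M (count_space UNIV)" "Measurable.pred M P" "Measurable.pred M Q"
    and eq: "\<And>v. \<P>(\<omega> in M. P \<omega> \<and> h \<omega> = v) = c * \<P>(\<omega> in M. Q \<omega> \<and> h \<omega> = v)"
  shows "\<P>(\<omega> in M. P \<omega>) = c * \<P>(\<omega> in M. Q \<omega>)"
proof -
  have sums: "(\<lambda>i. \<P>(\<omega> in M. P \<omega> \<and> to_nat (h \<omega>) = i)) sums \<P>(\<omega> in M. P \<omega>)"
    if [measurable]: "Measurable.pred M P" for P
  proof -
    have "to_nat \<in> measurable (count_space (UNIV :: 'b set)) (count_space (UNIV :: nat set))"
      by simp
    note [measurable] = measurable_compose[OF assms(1) this]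
    let ?A = "\<lambda>i. {\<omega>\<in>space M. P \<omega> \<and> to_nat (h \<omega>) = i}"
    have "(\<lambda>i. measure M (?A i)) sums measure M (\<Union>i. ?A i)"
      by (intro finite_measure_UNION) (auto simp: disjoint_family_on_def)
    also have "(\<Union>i. ?A i) = {\<omega>\<in>space M. P \<omega>}" by auto
    finally show ?thesis .
  qed
  have "\<P>(\<omega> in M. P \<omega> \<and> to_nat (h \<omega>) = i) = c * \<P>(\<omega> in M. Q \<omega> \<and> to_nat (h \<omega>) = i)" for i
  proof (cases "i \<in> range (to_nat :: 'b \<Rightarrow> nat)")
    case True
    then obtain v :: 'b where "i = to_nat v" by auto
    then show ?thesis using eq[of v] by simp
  next
    case False
    then have "\<And>\<omega>. to_nat (h \<omega>) \<noteq> i" by blast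
    then show ?thesis by simp
  qed
  then show ?thesis
    using sums_unique2[OF sums[OF assms(2)]] sums_mult[OF sums[OF assms(3)], of c] by simp
qed

lemma prob_finite_split:
  assumes "finite N" and [measurable]: "Y \<in> measurable M (count_space UNIV)" "Measurable.pred M P"
  shows "\<P>(\<omega> in M. P \<omega>) = (\<Sum>z\<in>N. \<P>(\<omega> in M. P \<omega> \<and> Y \<omega> = z)) + \<P>(\<omega> in M. P \<omega> \<and> Y \<omega> \<notin> N)"
  using assms(1)
proof induction
  have [measurable]: "Measurable.pred M (\<lambda>\<omega>. Y \<omega> \<notin> N)" for N
    by (rule measurable_compose[OF assms(2)]) simp
  case (insert z N)
  have "\<P>(\<omega> in M. P \<omega> \<and> Y \<omega> \<notin> N) =
      measure M ({\<omega>\<in>space M. P \<omega> \<and> Y \<omega> = z} \<union> {\<omega>\<in>space M. P \<omega> \<and> Y \<omega> \<notin> insert z N})"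
    using insert by (intro arg_cong[of _ _ "measure M"]) auto
  also have "\<dots> = \<P>(\<omega> in M. P \<omega> \<and> Y \<omega> = z) + \<P>(\<omega> in M. P \<omega> \<and> Y \<omega> \<notin> insert z N)"
  proof (rule finite_measure_Union)
    show "{\<omega>\<in>space M. P \<omega> \<and> Y \<omega> = z} \<in> sets M" by measurable
    show "{\<omega>\<in>space M. P \<omega> \<and> Y \<omega> \<notin> insert z N} \<in> sets M" by measurable
  qed auto
  finally show ?case using insert by simp
qed simp

text \<open>\<open>markov_chain\<close> conditions on complete histories only. Splitting along the
  countably many histories carries the transition rule over to any event \<open>R\<close> of the
  past.\<close>

lemma prob_step:
  "\<P>(\<omega> in M. R (hist k \<omega>) \<and> X k \<omega> = x \<and> X (Suc k) \<omega> = y) =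
    perturbed_transition M X x y * \<P>(\<omega> in M. R (hist k \<omega>) \<and> X k \<omega> = x)"
proof (rule prob_countable_split[where h = "hist k"])
  fix l
  let ?E = "\<P>(\<omega> in M. \<forall>i\<le>k. X i \<omega> = l ! i)"
  let ?F = "\<P>(\<omega> in M. X (Suc k) \<omega> = y \<and> (\<forall>i\<le>k. X i \<omega> = l ! i))"
  have *: "?F = perturbed_transition M X (l ! k) y * ?E"
  proof (cases "?E > 0")
    case True
    then have "\<P>(\<omega> in M. X (Suc k) \<omega> = y \<bar> \<forall>i\<le>k. X i \<omega> = l ! i) = perturbed_transition M X (l ! k) y"
      by (rule markov)
    then have "?F / ?E = perturbed_transition M X (l ! k) y" unfolding cond_prob_def .
    moreover have "?E \<noteq> 0" using True by linarith
    ultimately show ?thesis by (rule nonzero_divide_eq_eq[THEN iffD1, rotated])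
  next
    \<comment> \<open>Conditioning on a null history gives no information, but then both sides are
      zero.\<close>
    case False
    moreover have "?E \<ge> 0" "?F \<ge> 0" by (rule measure_nonneg)+
    moreover have "?F \<le> ?E" by (rule finite_measure_mono) auto
    ultimately have "?E = 0" "?F = 0" by linarith+
    then show ?thesis by (simp only: mult_zero_right)
  qed
  show "\<P>(\<omega> in M. (R (hist k \<omega>) \<and> X k \<omega> = x \<and> X (Suc k) \<omega> = y) \<and> hist k \<omega> = l) =
      perturbed_transition M X x y * \<P>(\<omega> in M. (R (hist k \<omega>) \<and> X k \<omega> = x) \<and> hist k \<omega> = l)"
  proof (cases "R l \<and> length l = Suc k \<and> l ! k = x")
    case True
    have hist: "hist k \<omega> = l \<longleftrightarrow> (\<forall>i\<le>k. X i \<omega> = l ! i)" for \<omega>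
      unfolding hist_eq_iff using True by blast
    have past: "R (hist k \<omega>) \<and> X k \<omega> = x" if "hist k \<omega> = l" for \<omega>
    proof -
      have "X k \<omega> = l ! k" using that unfolding hist by simp
      then show ?thesis using True that by simp
    qed
    have "(R (hist k \<omega>) \<and> X k \<omega> = x) \<and> hist k \<omega> = l \<longleftrightarrow> (\<forall>i\<le>k. X i \<omega> = l ! i)"
      "(R (hist k \<omega>) \<and> X k \<omega> = x \<and> X (Suc k) \<omega> = y) \<and> hist k \<omega> = l \<longleftrightarrow>
        X (Suc k) \<omega> = y \<and> (\<forall>i\<le>k. X i \<omega> = l ! i)" for \<omega>
      unfolding hist[symmetric] using past by blast+
    then show ?thesis using * True by (simp only:)
  next
    case False
    then have "\<not> ((R (hist k \<omega>) \<and> X k \<omega> = x) \<and> hist k \<omega> = l)" for \<omega>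
    proof -
      have "hist k \<omega> ! k = X k \<omega>" "length (hist k \<omega>) = Suc k"
        by (simp_all add: hist_nth) (simp add: hist_def)
      then show ?thesis using False by blast
    qed
    then have "{\<omega>\<in>space M. (R (hist k \<omega>) \<and> X k \<omega> = x) \<and> hist k \<omega> = l} = {}"
      "{\<omega>\<in>space M. (R (hist k \<omega>) \<and> X k \<omega> = x \<and> X (Suc k) \<omega> = y) \<and> hist k \<omega> = l} = {}"
      by blast+
    then show ?thesis by (simp only: measure_empty mult_zero_right)
  qed
qed measurable

lemma hist_Suc: "butlast (hist (Suc k) \<omega>) = hist k \<omega>"
  by (simp add: hist_def butlast_append)

text \<open>Markov property at time \<open>k\<close> by first-step analysis: until it meets the
  origin the chain moves like the simple random walk. The past \<open>R\<close> is arbitrary because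
  each step of the induction adds the state just left to it.\<close>

lemma prob_avoid:
  "\<P>(\<omega> in M. R (hist k \<omega>) \<and> X k \<omega> = x \<and> (\<forall>i\<le>j. X (k + i) \<omega> \<noteq> 0)) =
    avoid j x * \<P>(\<omega> in M. R (hist k \<omega>) \<and> X k \<omega> = x)"
proof (induction j arbitrary: k R x)
  case 0
  have "{\<omega>\<in>space M. R (hist k \<omega>) \<and> X k \<omega> = x \<and> (\<forall>i\<le>0. X (k + i) \<omega> \<noteq> 0)} =
      (if x = 0 then {} else {\<omega>\<in>space M. R (hist k \<omega>) \<and> X k \<omega> = x})"
    by auto
  then show ?case by simp
next
  case (Suc j)
  show ?case
  proof (cases "x = 0")
    case True
    then have "{\<omega>\<in>space M. R (hist k \<omega>) \<and> X k \<omega> = x \<and> (\<forall>i\<le>Suc j. X (k + i) \<omega> \<noteq> 0)} = {}"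
      by force
    then show ?thesis using True by (simp only: measure_empty) simp
  next
    case False
    let ?N = "nearest_neighbours x"
    let ?A = "\<lambda>\<omega>. R (hist k \<omega>) \<and> X k \<omega> = x"
    let ?E = "\<lambda>\<omega>. R (hist k \<omega>) \<and> X k \<omega> = x \<and> (\<forall>i\<le>Suc j. X (k + i) \<omega> \<noteq> 0)"
    have step: "\<P>(\<omega> in M. ?A \<omega> \<and> X (Suc k) \<omega> = z) = \<P>(\<omega> in M. ?A \<omega>) / 4" if "z \<in> ?N" for z
      using prob_step[of R k x z] False that by (simp add: perturbed_transition_def conj_assoc)
    have "(\<Sum>z\<in>?N. \<P>(\<omega> in M. ?A \<omega> \<and> X (Suc k) \<omega> = z)) = (\<Sum>z\<in>?N. \<P>(\<omega> in M. ?A \<omega>) / 4)"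
      using step by (rule sum.cong[OF refl])
    also have "\<dots> = \<P>(\<omega> in M. ?A \<omega>)" by simp
    \<comment> \<open>The four neighbours carry all the mass, so landing elsewhere is a null
      event.\<close>
    finally have "\<P>(\<omega> in M. ?A \<omega> \<and> X (Suc k) \<omega> \<notin> ?N) = 0"
      using prob_finite_split[of ?N "X (Suc k)" ?A] by simp
    moreover have "\<P>(\<omega> in M. ?E \<omega> \<and> X (Suc k) \<omega> \<notin> ?N) \<le> \<P>(\<omega> in M. ?A \<omega> \<and> X (Suc k) \<omega> \<notin> ?N)"
      by (rule finite_measure_mono) auto
    moreover have "\<P>(\<omega> in M. ?E \<omega> \<and> X (Suc k) \<omega> \<notin> ?N) \<ge> 0" by (rule measure_nonneg)
    ultimately have 0: "\<P>(\<omega> in M. ?E \<omega> \<and> X (Suc k) \<omega> \<notin> ?N) = 0" by linarith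
    have "\<P>(\<omega> in M. ?E \<omega> \<and> X (Suc k) \<omega> = z) = avoid j z * (\<P>(\<omega> in M. ?A \<omega>) / 4)" if "z \<in> ?N" for z
    proof -
      \<comment> \<open>Expresses the past up to \<open>k\<close> and the state \<open>x\<close> at
        time \<open>k\<close> as a condition on the history up to \<open>Suc k\<close>;
        \<open>butlast\<close> drops the newest state.\<close>
      let ?R = "\<lambda>l. R (butlast l) \<and> l ! k = x"
      have "?R (hist (Suc k) \<omega>) \<longleftrightarrow> ?A \<omega>" for \<omega>
        by (auto simp: hist_Suc hist_nth)
      moreover have "?E \<omega> \<and> X (Suc k) \<omega> = z \<longleftrightarrow>
          ?A \<omega> \<and> X (Suc k) \<omega> = z \<and> (\<forall>i\<le>j. X (Suc k + i) \<omega> \<noteq> 0)" for \<omega>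
      proof -
        have "(\<forall>i\<le>Suc j. X (k + i) \<omega> \<noteq> 0) \<longleftrightarrow> X k \<omega> \<noteq> 0 \<and> (\<forall>i\<le>j. X (Suc k + i) \<omega> \<noteq> 0)"
          using All_less_Suc2[of "Suc j" "\<lambda>i. X (k + i) \<omega> \<noteq> 0"] by (simp add: less_Suc_eq_le)
        then show ?thesis using False by blast
      qed
      ultimately show ?thesis
        using Suc[of ?R "Suc k" z] step[OF that] by (simp only:)
    qed
    then have "(\<Sum>z\<in>?N. \<P>(\<omega> in M. ?E \<omega> \<and> X (Suc k) \<omega> = z)) =
        (\<Sum>z\<in>?N. avoid j z * (\<P>(\<omega> in M. ?A \<omega>) / 4))"
      by (rule sum.cong[OF refl])
    moreover have "\<P>(\<omega> in M. ?E \<omega>) = (\<Sum>z\<in>?N. \<P>(\<omega> in M. ?E \<omega> \<and> X (Suc k) \<omega> = z)) +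
        \<P>(\<omega> in M. ?E \<omega> \<and> X (Suc k) \<omega> \<notin> ?N)"
      by (rule prob_finite_split[OF finite_nearest_neighbours]) measurable
    ultimately have "\<P>(\<omega> in M. ?E \<omega>) = (\<Sum>z\<in>?N. avoid j z * (\<P>(\<omega> in M. ?A \<omega>) / 4))"
      using 0 by linarith
    also have "\<dots> = (\<Sum>z\<in>?N. avoid j z) * (\<P>(\<omega> in M. ?A \<omega>) / 4)"
      by (rule sum_distrib_right[symmetric])
    also have "\<dots> = avoid (Suc j) x * \<P>(\<omega> in M. ?A \<omega>)" using False by simp
    finally show ?thesis .
  qed
qed

section \<open>Jumps from the origin\<close>

lemma finite_ball: "finite {x. norm (real_point x) \<le> R}"
proof (rule inj_on_finite)
  show "inj_on (\<lambda>x. (x$1, x$2)) {x::int^2. norm (real_point x) \<le> R}"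
    by (auto simp: inj_on_def vec_eq_iff forall_2)
  have "x $ i \<in> {-\<lfloor>R\<rfloor>..\<lfloor>R\<rfloor>}" if "norm (real_point x) \<le> R" for x :: "int^2" and i
  proof -
    have "\<bar>real_point x $ i\<bar> \<le> R" using component_le_norm_cart[of "real_point x" i] that by simp
    then have "real_of_int \<bar>x $ i\<bar> \<le> R" by (simp add: real_point_def)
    then show ?thesis by (simp add: le_floor_iff abs_le_iff) linarith
  qed
  then show "(\<lambda>x. (x$1, x$2)) ` {x::int^2. norm (real_point x) \<le> R} \<subseteq> {-\<lfloor>R\<rfloor>..\<lfloor>R\<rfloor>} \<times> {-\<lfloor>R\<rfloor>..\<lfloor>R\<rfloor>}"
    by (simp add: image_subset_iff)
qed auto

lemma prob_jump:
  "\<P>(\<omega> in M. X k \<omega> = 0 \<and> X (Suc k) \<omega> = y) = \<P>(\<omega> in M. X 1 \<omega> = y) * \<P>(\<omega> in M. X k \<omega> = 0)"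
  using prob_step[of "\<lambda>_. True" k 0 y] by (simp add: perturbed_transition_def)

text \<open>The landing points within distance \<open>t\<close> are finitely many, so the law of the
  jump is summed there and then complemented.\<close>

lemma prob_jump_gt:
  "\<P>(\<omega> in M. X k \<omega> = 0 \<and> norm (real_point (X (Suc k) \<omega>)) > t) =
    \<P>(\<omega> in M. norm (real_point (X 1 \<omega>)) > t) * \<P>(\<omega> in M. X k \<omega> = 0)"
proof -
  let ?N = "{x. norm (real_point x) \<le> t}"
  let ?S = "\<Sum>z\<in>?N. \<P>(\<omega> in M. X 1 \<omega> = z)"
  have "\<P>(\<omega> in M. X k \<omega> = 0) = (\<Sum>z\<in>?N. \<P>(\<omega> in M. X k \<omega> = 0 \<and> X (Suc k) \<omega> = z))
      + \<P>(\<omega> in M. X k \<omega> = 0 \<and> X (Suc k) \<omega> \<notin> ?N)"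
    by (rule prob_finite_split[OF finite_ball]) measurable
  then have "\<P>(\<omega> in M. X k \<omega> = 0 \<and> X (Suc k) \<omega> \<notin> ?N) = (1 - ?S) * \<P>(\<omega> in M. X k \<omega> = 0)"
    unfolding prob_jump sum_distrib_right[symmetric] by (simp add: left_diff_distrib)
  moreover have "1 = ?S + \<P>(\<omega> in M. X 1 \<omega> \<notin> ?N)"
    using prob_finite_split[OF finite_ball, of "X 1" "\<lambda>_. True" t] prob_space by simp
  then have "1 - ?S = \<P>(\<omega> in M. X 1 \<omega> \<notin> ?N)" by linarith
  ultimately have "\<P>(\<omega> in M. X k \<omega> = 0 \<and> X (Suc k) \<omega> \<notin> ?N) = \<P>(\<omega> in M. X 1 \<omega> \<notin> ?N) * \<P>(\<omega> in M. X k \<omega> = 0)"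
    by simp
  then show ?thesis by (simp add: not_le)
qed

text \<open>Splits according to the landing point: within distance \<open>R\<close> survival
  contributes the factor \<open>B\<close>, while a jump beyond \<open>R\<close> is counted as
  surviving with certainty.\<close>

lemma prob_survival_le:
  assumes B: "\<And>x. norm (real_point x) \<le> R \<Longrightarrow> avoid j x \<le> B" and "B \<ge> 0"
  shows "\<P>(\<omega> in M. X k \<omega> = 0 \<and> (\<forall>i\<le>j. X (Suc k + i) \<omega> \<noteq> 0)) \<le>
    (\<P>(\<omega> in M. norm (real_point (X 1 \<omega>)) > R) + B) * \<P>(\<omega> in M. X k \<omega> = 0)"
proof -
  let ?N = "{x. norm (real_point x) \<le> R}"
  let ?E = "\<lambda>\<omega>. X k \<omega> = 0 \<and> (\<forall>i\<le>j. X (Suc k + i) \<omega> \<noteq> 0)"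
  have "\<P>(\<omega> in M. ?E \<omega>) = (\<Sum>z\<in>?N. \<P>(\<omega> in M. ?E \<omega> \<and> X (Suc k) \<omega> = z)) +
      \<P>(\<omega> in M. ?E \<omega> \<and> X (Suc k) \<omega> \<notin> ?N)"
    by (rule prob_finite_split[OF finite_ball]) measurable
  also have "\<dots> \<le> (\<Sum>z\<in>?N. B * (\<P>(\<omega> in M. X 1 \<omega> = z) * \<P>(\<omega> in M. X k \<omega> = 0))) +
      \<P>(\<omega> in M. X k \<omega> = 0 \<and> norm (real_point (X (Suc k) \<omega>)) > R)"
  proof (intro add_mono sum_mono)
    fix z assume z: "z \<in> ?N"
    have "hist (Suc k) \<omega> ! k = X k \<omega>" for \<omega> by (simp add: hist_nth)
    then have "\<P>(\<omega> in M. ?E \<omega> \<and> X (Suc k) \<omega> = z) = avoid j z * \<P>(\<omega> in M. X k \<omega> = 0 \<and> X (Suc k) \<omega> = z)"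
      using prob_avoid[of "\<lambda>l. l ! k = 0" "Suc k" z j] by (simp add: conj_ac)
    also have "\<dots> \<le> B * \<P>(\<omega> in M. X k \<omega> = 0 \<and> X (Suc k) \<omega> = z)"
      using B z by (intro mult_right_mono) auto
    finally show "\<P>(\<omega> in M. ?E \<omega> \<and> X (Suc k) \<omega> = z) \<le> B * (\<P>(\<omega> in M. X 1 \<omega> = z) * \<P>(\<omega> in M. X k \<omega> = 0))"
      by (simp only: prob_jump)
  next
    show "\<P>(\<omega> in M. ?E \<omega> \<and> X (Suc k) \<omega> \<notin> ?N) \<le> \<P>(\<omega> in M. X k \<omega> = 0 \<and> norm (real_point (X (Suc k) \<omega>)) > R)"
      by (rule finite_measure_mono) auto
  qed
  also have "(\<Sum>z\<in>?N. B * (\<P>(\<omega> in M. X 1 \<omega> = z) * \<P>(\<omega> in M. X k \<omega> = 0))) =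
      (\<Sum>z\<in>?N. \<P>(\<omega> in M. X 1 \<omega> = z)) * (B * \<P>(\<omega> in M. X k \<omega> = 0))"
    unfolding sum_distrib_right by (simp add: mult_ac)
  also have "\<dots> \<le> 1 * (B * \<P>(\<omega> in M. X k \<omega> = 0))"
  proof (intro mult_right_mono mult_nonneg_nonneg assms(2) measure_nonneg)
    show "(\<Sum>z\<in>?N. \<P>(\<omega> in M. X 1 \<omega> = z)) \<le> 1"
    proof -
      have "1 = (\<Sum>z\<in>?N. \<P>(\<omega> in M. X 1 \<omega> = z)) + \<P>(\<omega> in M. X 1 \<omega> \<notin> ?N)"
        using prob_finite_split[OF finite_ball, of "X 1" "\<lambda>_. True" R] prob_space by simp
      moreover have "\<P>(\<omega> in M. X 1 \<omega> \<notin> ?N) \<ge> 0" by (rule measure_nonneg)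
      ultimately show ?thesis by linarith
    qed
  qed
  finally show ?thesis by (simp add: prob_jump_gt distrib_right)
qed

text \<open>From a landing point beyond \<open>t \<ge> j\<close> the origin cannot be reached in
  \<open>j\<close> steps, so survival is free; the identity is verified for each landing point
  \<open>v\<close>.\<close>

lemma prob_big_jump:
  assumes "real j \<le> t"
  shows "\<P>(\<omega> in M. X k \<omega> = 0 \<and> norm (real_point (X (Suc k) \<omega>)) > t \<and> (\<forall>i\<le>j. X (Suc k + i) \<omega> \<noteq> 0)) =
    \<P>(\<omega> in M. norm (real_point (X 1 \<omega>)) > t) * \<P>(\<omega> in M. X k \<omega> = 0)"
proof -
  have "\<P>(\<omega> in M. X k \<omega> = 0 \<and> norm (real_point (X (Suc k) \<omega>)) > t \<and> (\<forall>i\<le>j. X (Suc k + i) \<omega> \<noteq> 0)) =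
    1 * \<P>(\<omega> in M. X k \<omega> = 0 \<and> norm (real_point (X (Suc k) \<omega>)) > t)"
  proof (rule prob_countable_split[where h = "X (Suc k)"])
    fix v
    let ?R = "\<lambda>l. l ! k = 0 \<and> norm (real_point (l ! Suc k)) > t"
    have R: "?R (hist (Suc k) \<omega>) \<longleftrightarrow> X k \<omega> = 0 \<and> norm (real_point (X (Suc k) \<omega>)) > t" for \<omega>
      by (simp add: hist_nth)
    show "\<P>(\<omega> in M. (X k \<omega> = 0 \<and> norm (real_point (X (Suc k) \<omega>)) > t \<and> (\<forall>i\<le>j. X (Suc k + i) \<omega> \<noteq> 0)) \<and> X (Suc k) \<omega> = v) =
        1 * \<P>(\<omega> in M. (X k \<omega> = 0 \<and> norm (real_point (X (Suc k) \<omega>)) > t) \<and> X (Suc k) \<omega> = v)"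
    proof (cases "norm (real_point v) > t")
      case True
      then have "avoid j v = 1" using assms by (intro avoid_eq_1) simp
      then show ?thesis
        using prob_avoid[of ?R "Suc k" v j] unfolding R by (simp add: conj_ac)
    next
      case False
      then have "{\<omega>\<in>space M. (X k \<omega> = 0 \<and> norm (real_point (X (Suc k) \<omega>)) > t \<and> (\<forall>i\<le>j. X (Suc k + i) \<omega> \<noteq> 0)) \<and> X (Suc k) \<omega> = v} = {}"
        "{\<omega>\<in>space M. (X k \<omega> = 0 \<and> norm (real_point (X (Suc k) \<omega>)) > t) \<and> X (Suc k) \<omega> = v} = {}"
        by auto
      then show ?thesis by (simp only: measure_empty)
    qed
  qed measurable
  then show ?thesis by (simp add: prob_jump_gt)
qed

text \<open>The walk starts at the origin almost surely, so almost surely exactly one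
  \<open>k \<le> N\<close> is its last visit up to time \<open>N\<close>.\<close>

lemma last_exit: "(\<Sum>k\<le>N. \<P>(\<omega> in M. X k \<omega> = 0 \<and> (\<forall>i\<in>{Suc k..N}. X i \<omega> \<noteq> 0))) = 1"
proof -
  let ?A = "\<lambda>k. {\<omega>\<in>space M. X k \<omega> = 0 \<and> (\<forall>i\<in>{Suc k..N}. X i \<omega> \<noteq> 0)}"
  have "measure M (\<Union>k\<le>N. ?A k) = (\<Sum>k\<le>N. measure M (?A k))"
  proof (rule finite_measure_finite_Union)
    show "?A ` {..N} \<subseteq> sets M" by (intro image_subsetI) measurable
    show "disjoint_family_on ?A {..N}"
      by (rule disjoint_family_on_less) auto
  qed simp
  moreover have "measure M (\<Union>k\<le>N. ?A k) = 1"
  proof (rule prob_eq_1[THEN iffD2])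
    have "AE \<omega> in M. X 0 \<omega> = 0" using walk by (simp add: perturbed_walk_def)
    then show "AE \<omega> in M. \<omega> \<in> (\<Union>k\<le>N. ?A k)"
      using AE_space
    proof eventually_elim
      case (elim \<omega>)
      define k where "k = Max {k. k \<le> N \<and> X k \<omega> = 0}"
      have fin: "finite {k. k \<le> N \<and> X k \<omega> = 0}" by simp
      have "k \<in> {k. k \<le> N \<and> X k \<omega> = 0}" unfolding k_def using elim by (intro Max_in fin) auto
      moreover have "X i \<omega> \<noteq> 0" if "i \<in> {Suc k..N}" for i
      proof
        assume "X i \<omega> = 0"
        then have "i \<le> k" unfolding k_def using that by (intro Max_ge[OF fin]) simp
        then show False using that by simp
      qed
      ultimately show ?case using elim by (intro UN_I[of k]) auto
    qed
  qed auto
  ultimately show ?thesis by simp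
qed

text \<open>Summing the last-exit decomposition over all horizons below \<open>n\<close> bounds the expected number of
  visits to the origin from below. The events that \<open>k\<close> is the last zero up to time \<open>n\<close> and that the jump at
  time \<open>k\<close> exceeds \<open>t\<close> are disjoint, and since \<open>t \<ge> n\<close>, a jump exceeding \<open>t\<close> from a zero at time
  \<open>k\<close> makes \<open>k\<close> the last one automatically.\<close>

lemma exit_prob:
  assumes t: "real n \<le> t" and B: "\<And>x. norm (real_point x) \<le> R \<Longrightarrow> avoid m x \<le> B" and "B \<ge> 0"
  shows "real n * \<P>(\<omega> in M. norm (real_point (X 1 \<omega>)) > t) \<le>
    \<P>(\<omega> in M. \<exists>k\<in>{1..n}. norm (real_point (X k \<omega>)) > t) *
      (real m + 1 + real n * (\<P>(\<omega> in M. norm (real_point (X 1 \<omega>)) > R) + B))"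
proof -
  define r where "r k = \<P>(\<omega> in M. X k \<omega> = 0)" for k
  define p where "p = \<P>(\<omega> in M. norm (real_point (X 1 \<omega>)) > t)"
  define \<epsilon> where "\<epsilon> = \<P>(\<omega> in M. norm (real_point (X 1 \<omega>)) > R) + B"
  \<comment> \<open>Bound for the conditional probability of no return within \<open>j\<close> steps
    after a visit: trivial up to \<open>m\<close>, and \<open>\<epsilon>\<close> afterwards.\<close>
  define q where "q j = (if j \<le> m then 1 else \<epsilon>)" for j
  have r0: "r k \<ge> 0" for k by (simp add: r_def)
  have p0: "p \<ge> 0" by (simp add: p_def)
  have \<epsilon>0: "\<epsilon> \<ge> 0" using assms(3) by (simp add: \<epsilon>_def)
  have q0: "q j \<ge> 0" for j using \<epsilon>0 by (simp add: q_def)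
  have surv: "\<P>(\<omega> in M. X k \<omega> = 0 \<and> (\<forall>i\<in>{Suc k..N}. X i \<omega> \<noteq> 0)) \<le> r k * q (N - k)" if "k \<le> N" for k N
  proof (cases "N - k \<le> m")
    case True
    have "\<P>(\<omega> in M. X k \<omega> = 0 \<and> (\<forall>i\<in>{Suc k..N}. X i \<omega> \<noteq> 0)) \<le> r k"
      unfolding r_def by (rule finite_measure_mono) auto
    then show ?thesis using True by (simp add: q_def)
  next
    case False
    \<comment> \<open>The jump itself uses one of the \<open>N - k\<close> steps, leaving
      \<open>j\<close>; \<open>N - k > m\<close> yields \<open>j \<ge> m\<close>.\<close>
    define j where "j = N - k - 1"
    have j: "N = Suc k + j" "m \<le> j" using False by (auto simp: j_def)
    have "(\<forall>i\<in>{Suc k..N}. X i \<omega> \<noteq> 0) \<longleftrightarrow> (\<forall>i\<le>j. X (Suc k + i) \<omega> \<noteq> 0)" for \<omega>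
      unfolding j by (auto simp: le_iff_add)
    moreover have "avoid j x \<le> B" if "norm (real_point x) \<le> R" for x
      using B[OF that] avoid_antimono[OF j(2), of x] by simp
    ultimately show ?thesis
      using prob_survival_le[of R j B k] assms(3) False by (simp add: q_def \<epsilon>_def r_def mult.commute)
  qed
  have "real n = (\<Sum>N<n. 1)" by simp
  also have "\<dots> \<le> (\<Sum>N<n. \<Sum>k\<le>N. r k * q (N - k))"
  proof (rule sum_mono)
    fix N
    show "1 \<le> (\<Sum>k\<le>N. r k * q (N - k))"
      unfolding last_exit[of N, symmetric] by (intro sum_mono surv) auto
  qed
  also have "\<dots> = (\<Sum>(N, k)\<in>(SIGMA N:{..<n}. {..N}). r k * q (N - k))"
    by (simp add: sum.Sigma)
  \<comment> \<open>Ordered by the last visit \<open>k\<close> and the time \<open>j\<close> elapsed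
    since; the range of \<open>j\<close> is then enlarged to all of \<open>{..<n}\<close>, which
    decouples the two sums.\<close>
  also have "\<dots> = (\<Sum>(k, j)\<in>(SIGMA k:{..<n}. {..<n - k}). r k * q j)"
    by (rule sum.reindex_bij_witness[of _ "\<lambda>(k, j). (k + j, k)" "\<lambda>(N, k). (k, N - k)"]) auto
  also have "\<dots> = (\<Sum>k<n. r k * (\<Sum>j<n - k. q j))"
    by (simp add: sum.Sigma sum_distrib_left)
  also have "\<dots> \<le> (\<Sum>k<n. r k * (\<Sum>j<n. q j))"
    by (intro sum_mono mult_left_mono sum_mono2 r0 q0) auto
  also have "\<dots> = (\<Sum>k<n. r k) * (\<Sum>j<n. q j)" by (simp add: sum_distrib_right)
  finally have green: "real n \<le> (\<Sum>k<n. r k) * (\<Sum>j<n. q j)" .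
  have "(\<Sum>j<n. q j) \<le> (\<Sum>j<n. of_bool (j \<le> m) + \<epsilon>)"
    by (intro sum_mono) (auto simp: q_def \<epsilon>0)
  also have "\<dots> = real (card {j. j < n \<and> j \<le> m}) + real n * \<epsilon>"
    by (simp add: sum.distrib of_bool_def sum.If_cases Int_def)
  also have "card {j. j < n \<and> j \<le> m} \<le> card {..m}" by (rule card_mono) auto
  finally have q: "(\<Sum>j<n. q j) \<le> real m + 1 + real n * \<epsilon>" by simp

  \<comment> \<open>After the jump \<open>n - Suc k\<close> steps remain up to time
    \<open>n\<close>, so a later visit before \<open>n\<close> excludes the event for
    \<open>k\<close>, and the events are disjoint.\<close>
  let ?E = "\<lambda>k. {\<omega>\<in>space M. X k \<omega> = 0 \<and> norm (real_point (X (Suc k) \<omega>)) > t \<and> (\<forall>i\<le>n - Suc k. X (Suc k + i) \<omega> \<noteq> 0)}"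
  have "(\<Sum>k<n. r k) * p = (\<Sum>k<n. measure M (?E k))"
    unfolding sum_distrib_right
  proof (rule sum.cong[OF refl])
    fix k assume "k \<in> {..<n}"
    then show "r k * p = measure M (?E k)"
      using t by (subst prob_big_jump) (auto simp: p_def r_def)
  qed
  also have "\<dots> = measure M (\<Union>k<n. ?E k)"
  proof (rule sym, rule finite_measure_finite_Union)
    show "?E ` {..<n} \<subseteq> sets M" by (intro image_subsetI) measurable
    show "disjoint_family_on ?E {..<n}"
    proof (rule disjoint_family_on_less)
      fix k l assume that: "k \<in> {..<n}" "l \<in> {..<n}" "k < l"
      have "\<exists>i\<le>n - Suc k. Suc k + i = l" using that by (intro exI[of _ "l - Suc k"]) auto
      then show "?E k \<inter> ?E l = {}" by blast
    qed
  qed simp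
  also have "\<dots> \<le> \<P>(\<omega> in M. \<exists>k\<in>{1..n}. norm (real_point (X k \<omega>)) > t)" (is "_ \<le> ?P")
    by (rule finite_measure_mono) (auto intro!: bexI[of _ "Suc _"])
  finally have P: "(\<Sum>k<n. r k) * p \<le> ?P" .
  have "real n * p \<le> ((\<Sum>k<n. r k) * (\<Sum>j<n. q j)) * p" by (intro mult_right_mono green p0)
  also have "\<dots> = ((\<Sum>k<n. r k) * p) * (\<Sum>j<n. q j)" by (simp add: mult_ac)
  also have "\<dots> \<le> ?P * (real m + 1 + real n * \<epsilon>)"
    by (intro mult_mono P q sum_nonneg q0 measure_nonneg)
  finally show ?thesis unfolding p_def \<epsilon>_def .
qed

end

section \<open>Compact sets of cadlag paths\<close>

definition bounded_upto :: "real \<Rightarrow> real \<Rightarrow> (real \<Rightarrow> 'a::real_normed_vector) \<Rightarrow> bool" where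
  "bounded_upto T c x \<longleftrightarrow> (\<forall>t\<in>{0..T}. norm (x t) \<le> c)"

lemma tendsto_left_limit:
  assumes "x \<in> cadlag" "t > 0"
  shows "(x \<longlongrightarrow> left_limit x t) (at_left t)"
proof -
  obtain l where l: "(x \<longlongrightarrow> l) (at_left t)" using assms by (auto simp: cadlag_def)
  then have "Lim (at_left t) x = l" by (intro tendsto_Lim) auto
  then show ?thesis using l assms(2) by (simp add: left_limit_def)
qed

lemma left_limit_in_closed:
  assumes "x \<in> cadlag" "t > 0" "closed C" "b < t" "\<And>s. b < s \<Longrightarrow> s < t \<Longrightarrow> x s \<in> C"
  shows "left_limit x t \<in> C"
proof (rule Lim_in_closed_set[OF assms(3) _ _ tendsto_left_limit[OF assms(1,2)]])
  show "eventually (\<lambda>s. x s \<in> C) (at_left t)"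
    using assms(4,5) by (auto simp: eventually_at_left_field)
qed auto

text \<open>A closed ball that contains the values contains their left limits and, being convex, the
  jump segments.\<close>

lemma completed_graph_bound:
  assumes x: "x \<in> cadlag" and b: "bounded_upto T c x" and p: "p \<in> completed_graph T x"
  shows "norm (fst p) \<le> c"
proof -
  obtain z t where zt: "p = (z, t)" "t \<in> {0..T}" "z \<in> closed_segment (left_limit x t) (x t)"
    using p by (auto simp: completed_graph_def)
  have "x t \<in> cball 0 c" using b zt by (simp add: bounded_upto_def)
  moreover have "left_limit x t \<in> cball 0 c"
  proof (cases "t > 0")
    case True
    show ?thesis
      using b zt True by (intro left_limit_in_closed[OF x True closed_cball, of 0]) (auto simp: bounded_upto_def)
  next
    case False
    then show ?thesis using b zt by (simp add: bounded_upto_def left_limit_def)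
  qed
  ultimately have "closed_segment (left_limit x t) (x t) \<subseteq> cball 0 c"
    by (intro closed_segment_subset) auto
  then show ?thesis using zt by auto
qed

lemma completed_graph_self: "t \<in> {0..T} \<Longrightarrow> (x t, t) \<in> completed_graph T x"
  by (simp add: completed_graph_def)

text \<open>The property of a mode of convergence from which the boundedness of compact sets is
  derived. The slack \<open>\<epsilon>\<close> is there since the paths only approach the
  limit.\<close>

definition preserves_bounds ::
  "(real \<Rightarrow> (nat \<Rightarrow> real \<Rightarrow> 'a::real_normed_vector) \<Rightarrow> (real \<Rightarrow> 'a) \<Rightarrow> bool) \<Rightarrow> bool" where
  "preserves_bounds conv \<longleftrightarrow> (\<forall>T xs x c \<epsilon>. x \<in> cadlag \<longrightarrow> conv T xs x \<longrightarrow> bounded_upto T c x \<longrightarrow> \<epsilon> > 0 \<longrightarrow>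
     (\<forall>\<^sub>F n in sequentially. bounded_upto T (c + \<epsilon>) (xs n)))"

text \<open>A stronger mode inherits the property from a weaker one, so that a direct argument for
  J2 and M2 suffices.\<close>

lemma preserves_bounds_mono:
  assumes imp: "\<And>T xs x. conv T xs x \<Longrightarrow> conv' T xs x" and "preserves_bounds conv'"
  shows "preserves_bounds conv"
  unfolding preserves_bounds_def
proof (intro allI impI)
  fix T xs x c and \<epsilon> :: real
  assume "x \<in> cadlag" "conv T xs x" "bounded_upto T c x" "\<epsilon> > 0"
  then show "\<forall>\<^sub>F n in sequentially. bounded_upto T (c + \<epsilon>) (xs n)"
    using assms(2)[unfolded preserves_bounds_def, rule_format, OF _ imp] by metis
qed

lemma J1_conv_imp_J2_conv: "J1_conv T xs x \<Longrightarrow> J2_conv T xs x"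
  unfolding J1_conv_def J2_conv_def by blast

lemma preserves_bounds_J2: "preserves_bounds (J2_conv :: real \<Rightarrow> (nat \<Rightarrow> real \<Rightarrow> 'a::real_normed_vector) \<Rightarrow> _)"
  unfolding preserves_bounds_def
proof (intro allI impI)
  fix T c \<epsilon> :: real and xs :: "nat \<Rightarrow> real \<Rightarrow> 'a" and x
  assume "J2_conv T xs x" and b: "bounded_upto T c x" and \<epsilon>: "\<epsilon> > 0"
  then obtain \<phi> where \<phi>: "\<And>n. bij_betw (\<phi> n) {0..T} {0..T}"
    and lim: "uniform_limit {0..T} (\<lambda>n t. xs n t - x (\<phi> n t)) (\<lambda>t. 0) sequentially"
    unfolding J2_conv_def by blast
  from uniform_limitD[OF lim \<epsilon>]
  show "\<forall>\<^sub>F n in sequentially. bounded_upto T (c + \<epsilon>) (xs n)"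
  proof eventually_elim
    case (elim n)
    show ?case unfolding bounded_upto_def
    proof
      fix t assume t: "t \<in> {0..T}"
      then have "\<phi> n t \<in> {0..T}" using bij_betwE[OF \<phi>] by blast
      then have "norm (x (\<phi> n t)) \<le> c" using b by (simp add: bounded_upto_def)
      moreover have "norm (xs n t - x (\<phi> n t)) < \<epsilon>" using elim t by simp
      ultimately show "norm (xs n t) \<le> c + \<epsilon>"
        using norm_triangle_sub[of "xs n t" "x (\<phi> n t)"] by simp
    qed
  qed
qed

lemma preserves_bounds_J1: "preserves_bounds J1_conv"
  using J1_conv_imp_J2_conv preserves_bounds_J2 by (rule preserves_bounds_mono)

lemma preserves_bounds_M2: "preserves_bounds (M2_conv :: real \<Rightarrow> (nat \<Rightarrow> real \<Rightarrow> 'a::real_normed_vector) \<Rightarrow> _)"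
  unfolding preserves_bounds_def
proof (intro allI impI)
  fix T c \<epsilon> :: real and xs :: "nat \<Rightarrow> real \<Rightarrow> 'a" and x
  assume x: "x \<in> cadlag" and "M2_conv T xs x" and b: "bounded_upto T c x" and \<epsilon>: "\<epsilon> > 0"
  then have "\<forall>\<^sub>F n in sequentially.
      (\<forall>p\<in>completed_graph T x. \<exists>q\<in>completed_graph T (xs n). dist p q < \<epsilon>) \<and>
      (\<forall>q\<in>completed_graph T (xs n). \<exists>p\<in>completed_graph T x. dist p q < \<epsilon>)"
    unfolding M2_conv_def by blast
  then show "\<forall>\<^sub>F n in sequentially. bounded_upto T (c + \<epsilon>) (xs n)"
  proof eventually_elim
    case (elim n)
    show ?case unfolding bounded_upto_def
    proof
      fix t assume t: "t \<in> {0..T}"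
      then obtain p where p: "p \<in> completed_graph T x" "dist p (xs n t, t) < \<epsilon>"
        using elim completed_graph_self by blast
      have "norm (fst p) \<le> c" using completed_graph_bound[OF x b p(1)] .
      moreover have "dist (fst p) (xs n t) < \<epsilon>" using dist_fst_le[of p "(xs n t, t)"] p(2) by simp
      ultimately show "norm (xs n t) \<le> c + \<epsilon>"
        using norm_triangle_sub[of "xs n t" "fst p"] by (simp add: dist_norm norm_minus_commute)
    qed
  qed
qed

text \<open>Uniformly close representations match each point of one graph with the point of the same
  parameter on the other; the order along the graphs is forgotten.\<close>

lemma M1_conv_imp_M2_conv:
  assumes "M1_conv T xs x"
  shows "M2_conv T xs x"
  unfolding M2_conv_def
proof (intro allI impI)
  fix \<epsilon> :: real assume \<epsilon>: "\<epsilon> > 0"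
  obtain gs g where rep: "\<forall>n. parametric_rep T (xs n) (gs n)" "parametric_rep T x g"
    and lim: "uniform_limit {0..1} gs g sequentially"
    using assms unfolding M1_conv_def by blast
  have g: "gs n ` {0..1} = completed_graph T (xs n)" "g ` {0..1} = completed_graph T x" for n
    using rep by (simp_all add: parametric_rep_def)
  from uniform_limitD[OF lim \<epsilon>]
  show "\<forall>\<^sub>F n in sequentially.
     (\<forall>p\<in>completed_graph T x. \<exists>q\<in>completed_graph T (xs n). dist p q < \<epsilon>) \<and>
     (\<forall>q\<in>completed_graph T (xs n). \<exists>p\<in>completed_graph T x. dist p q < \<epsilon>)"
    unfolding g(1)[symmetric] g(2)[symmetric]
  proof eventually_elim
    case (elim n)
    then have "dist (g s) (gs n s) < \<epsilon>" if "s \<in> {0..1}" for s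
      using that by (simp add: dist_commute)
    then show ?case by blast
  qed
qed

lemma preserves_bounds_M1: "preserves_bounds M1_conv"
  using M1_conv_imp_M2_conv preserves_bounds_M2 by (rule preserves_bounds_mono)

section \<open>Boundedness and discontinuities of cadlag paths\<close>

lemma cadlag_bounded:
  assumes x: "x \<in> cadlag"
  shows "\<exists>c. bounded_upto T c x"
proof (cases "0 \<le> T")
  case True
  \<comment> \<open>Bisection reduces the claim to small intervals around a point. Around
    \<open>0\<close> these reach into the negative half-line, which the guard
    \<open>0 \<le> t\<close> excludes.\<close>
  have "\<exists>c. \<forall>t\<in>{0..T}. 0 \<le> t \<longrightarrow> norm (x t) \<le> c"
  proof (rule Bolzano[OF True, of "\<lambda>a b. \<exists>c. \<forall>t\<in>{a..b}. 0 \<le> t \<longrightarrow> norm (x t) \<le> c"])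
    fix a b d :: real
    assume "\<exists>c. \<forall>t\<in>{a..b}. 0 \<le> t \<longrightarrow> norm (x t) \<le> c" "\<exists>c. \<forall>t\<in>{b..d}. 0 \<le> t \<longrightarrow> norm (x t) \<le> c"
    then obtain c1 c2 where "\<forall>t\<in>{a..b}. 0 \<le> t \<longrightarrow> norm (x t) \<le> c1" "\<forall>t\<in>{b..d}. 0 \<le> t \<longrightarrow> norm (x t) \<le> c2"
      by blast
    then have "norm (x t) \<le> max c1 c2" if "t \<in> {a..d}" "0 \<le> t" for t
      using that by (cases "t \<le> b") (auto intro: le_max_iff_disj[THEN iffD2])
    then show "\<exists>c. \<forall>t\<in>{a..d}. 0 \<le> t \<longrightarrow> norm (x t) \<le> c" by blast
  next
    fix t :: real assume t: "0 \<le> t" "t \<le> T"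
    have "(x \<longlongrightarrow> x t) (at_right t)" using x t by (simp add: cadlag_def)
    from tendstoD[OF this, of 1] obtain b where b: "b > t" "\<And>s. t < s \<Longrightarrow> s < b \<Longrightarrow> dist (x s) (x t) < 1"
      by (auto simp: eventually_at_right_field)
    obtain a l where a: "a < t" "\<And>s. a < s \<Longrightarrow> s < t \<Longrightarrow> 0 \<le> s \<Longrightarrow> dist (x s) l < 1"
    proof (cases "t > 0")
      case True
      from tendstoD[OF tendsto_left_limit[OF x this], of 1] that show ?thesis
        by (auto simp: eventually_at_left_field)
    next
      case False
      then show ?thesis using t by (intro that[of "t - 1"]) auto
    qed
    define d where "d = min (b - t) (t - a)"
    have "norm (x s) \<le> norm (x t) + norm l + 1" if "\<bar>s - t\<bar> < d" "0 \<le> s" for s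
    proof -
      consider "s = t" | "t < s" "s < b" | "a < s" "s < t" using \<open>\<bar>s - t\<bar> < d\<close> unfolding d_def by linarith
      then show ?thesis
      proof cases
        case 2
        then have "norm (x s - x t) < 1" using b by (simp add: dist_norm)
        then show ?thesis using norm_triangle_sub[of "x s" "x t"] norm_ge_zero[of l] by linarith
      next
        case 3
        then have "norm (x s - l) < 1" using a that by (simp add: dist_norm)
        then show ?thesis using norm_triangle_sub[of "x s" l] norm_ge_zero[of "x t"] by linarith
      qed auto
    qed
    then have "\<forall>u v. u \<le> t \<and> t \<le> v \<and> v - u < d \<longrightarrow> (\<exists>c. \<forall>s\<in>{u..v}. 0 \<le> s \<longrightarrow> norm (x s) \<le> c)"
      by (intro allI impI exI[of _ "norm (x t) + norm l + 1"]) force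
    moreover have "d > 0" using a b by (simp add: d_def)
    ultimately show "\<exists>d>0. \<forall>u v. u \<le> t \<and> t \<le> v \<and> v - u < d \<longrightarrow> (\<exists>c. \<forall>s\<in>{u..v}. 0 \<le> s \<longrightarrow> norm (x s) \<le> c)"
      by blast
  qed
  then show ?thesis by (auto simp: bounded_upto_def)
qed (auto simp: bounded_upto_def)

text \<open>By bisection: since the one-sided limits at \<open>t\<close> exist, the path oscillates
  little on either side of \<open>t\<close>, so near \<open>t\<close> at most \<open>t\<close>
  itself is a jump time of this size.\<close>

lemma finite_large_jumps:
  assumes x: "x \<in> cadlag" and \<epsilon>: "\<epsilon> > 0" and ab: "0 \<le> a" "a \<le> b"
  shows "finite ({t. 0 < t \<and> dist (left_limit x t) (x t) > \<epsilon>} \<inter> {a..b})" (is "finite (?D \<inter> _)")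
proof (rule Bolzano[OF ab(2), of "\<lambda>a b. finite (?D \<inter> {a..b})"])
  fix a b c :: real assume "finite (?D \<inter> {a..b})" "finite (?D \<inter> {b..c})" "a \<le> b" "b \<le> c"
  moreover have "?D \<inter> {a..c} \<subseteq> ?D \<inter> {a..b} \<union> ?D \<inter> {b..c}" by auto
  ultimately show "finite (?D \<inter> {a..c})" by (meson finite_UnI finite_subset)
next
  fix t assume "a \<le> t" "t \<le> b"
  then have t: "0 \<le> t" using ab by simp
  \<comment> \<open>If all values on \<open>(u, v)\<close> are within \<open>\<epsilon> / 2\<close>
    of \<open>l\<close>, so are the left limits there, and a jump exceeding
    \<open>\<epsilon>\<close> is impossible.\<close>
  have small: "s \<notin> ?D" if "u < s" "s < v" and near: "\<And>r. u < r \<Longrightarrow> r < v \<Longrightarrow> dist l (x r) < \<epsilon> / 2" for s u v l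
  proof
    assume "s \<in> ?D"
    then have "s > 0" "dist (left_limit x s) (x s) > \<epsilon>" by auto
    have "left_limit x s \<in> cball l (\<epsilon> / 2)"
      using that near by (intro left_limit_in_closed[OF x \<open>s > 0\<close> closed_cball \<open>u < s\<close>]) force
    moreover have "dist l (x s) < \<epsilon> / 2" using near that by blast
    ultimately show False
      using \<open>dist (left_limit x s) (x s) > \<epsilon>\<close> dist_triangle[of "left_limit x s" "x s" l]
      by (simp add: dist_commute)
  qed
  have "(x \<longlongrightarrow> x t) (at_right t)" using x t by (simp add: cadlag_def)
  from tendstoD[OF this, of "\<epsilon> / 2"] \<epsilon> obtain v where v: "v > t" "\<And>s. t < s \<Longrightarrow> s < v \<Longrightarrow> dist (x t) (x s) < \<epsilon> / 2"
    by (auto simp: eventually_at_right_field dist_commute)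
  obtain u where u: "u < t" "\<And>s. u < s \<Longrightarrow> s < t \<Longrightarrow> s \<notin> ?D"
  proof (cases "t > 0")
    case True
    from tendstoD[OF tendsto_left_limit[OF x this], of "\<epsilon> / 2"] \<epsilon>
    obtain u where u: "u < t" "\<And>s. u < s \<Longrightarrow> s < t \<Longrightarrow> dist (left_limit x t) (x s) < \<epsilon> / 2"
      by (auto simp: eventually_at_left_field dist_commute)
    then show ?thesis using small that by blast
  next
    case False
    then show ?thesis using t by (intro that[of "t - 1"]) auto
  qed
  define d where "d = min (v - t) (t - u)"
  have "finite (?D \<inter> {u'..v'})" if "u' \<le> t" "t \<le> v'" "v' - u' < d" for u' v'
  proof (rule finite_subset)
    show "?D \<inter> {u'..v'} \<subseteq> {t}"
    proof
      fix s assume s: "s \<in> ?D \<inter> {u'..v'}"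
      then have "u' \<le> s" "s \<le> v'" by auto
      then have "s = t \<or> (t < s \<and> s < v) \<or> (u < s \<and> s < t)" using that unfolding d_def by linarith
      then consider "s = t" | "t < s" "s < v" | "u < s" "s < t" by blast
      then show "s \<in> {t}" using s u small[OF _ _ v(2)] by cases auto
    qed
  qed simp
  moreover have "d > 0" using u v by (simp add: d_def)
  ultimately show "\<exists>d>0. \<forall>u' v'. u' \<le> t \<and> t \<le> v' \<and> v' - u' < d \<longrightarrow> finite (?D \<inter> {u'..v'})" by blast
qed

text \<open>The discontinuities in \<open>[a, b]\<close> are the union over \<open>k\<close> of the
  finitely many jumps exceeding \<open>1 / (k + 1)\<close>, hence countable, whereas
  \<open>(a, b)\<close> is uncountable.\<close>

lemma cadlag_continuity_point:
  assumes x: "x \<in> cadlag" and ab: "0 \<le> a" "a < b"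
  obtains t where "a < t" "t < b" "isCont x t"
proof -
  let ?D = "\<lambda>\<epsilon>. {t. 0 < t \<and> dist (left_limit x t) (x t) > \<epsilon>} \<inter> {a..b}"
  define E where "E = (\<Union>k. ?D (1 / real (Suc k)))"
  have "countable E" unfolding E_def
  proof (rule countable_UN)
    show "countable (?D (1 / real (Suc k)))" for k
      using ab(2) by (intro countable_finite finite_large_jumps[OF x _ ab(1)]) auto
  qed auto
  moreover have "uncountable {a<..<b}" using ab by (simp add: uncountable_open_interval)
  ultimately have "\<not> {a<..<b} \<subseteq> E" using countable_subset by metis
  then obtain t where t: "t \<in> {a<..<b}" "t \<notin> E" by blast
  have t0: "t > 0" using t ab by simp
  have "left_limit x t = x t"
  proof (rule ccontr)
    assume "left_limit x t \<noteq> x t"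
    then have "dist (left_limit x t) (x t) > 0" by simp
    then obtain k where "1 / real (Suc k) < dist (left_limit x t) (x t)"
      using nat_approx_posE by blast
    then show False using t t0 by (auto simp: E_def)
  qed
  then have "(x \<longlongrightarrow> x t) (at_left t)" using tendsto_left_limit[OF x t0] by simp
  moreover have "(x \<longlongrightarrow> x t) (at_right t)" using x t0 by (simp add: cadlag_def)
  ultimately have "isCont x t" by (simp add: isCont_def filterlim_at_split)
  then show ?thesis using t that by auto
qed

text \<open>Asking for the bound on an interval larger than \<open>[0,1]\<close> makes the set open, because convergence
  is only available at the continuity points of the limit.\<close>

definition paths_bounded_past_1 :: "real \<Rightarrow> (real \<Rightarrow> 'a::real_normed_vector) set" where
  "paths_bounded_past_1 r = {x \<in> cadlag. \<exists>T>1. \<exists>c<r. bounded_upto T c x}"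

lemma openin_paths_bounded_past_1:
  fixes conv :: "real \<Rightarrow> (nat \<Rightarrow> real \<Rightarrow> 'a::real_normed_vector) \<Rightarrow> (real \<Rightarrow> 'a) \<Rightarrow> bool"
  assumes "preserves_bounds conv"
  shows "openin (cadlag_topology conv) (paths_bounded_past_1 r)"
  unfolding openin_cadlag_topology
proof (intro conjI ballI allI impI)
  show "(paths_bounded_past_1 r :: (real \<Rightarrow> 'a) set) \<subseteq> cadlag" by (auto simp: paths_bounded_past_1_def)
next
  fix x xs assume "x \<in> paths_bounded_past_1 r" and xs: "(\<forall>n. xs n \<in> cadlag) \<and> halfline_conv conv xs x"
  then obtain T c where x: "x \<in> cadlag" and T: "T > 1" and c: "c < r" and b: "bounded_upto T c x"
    by (auto simp: paths_bounded_past_1_def)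
  \<comment> \<open>The bound is known up to \<open>T\<close>, but convergence only at continuity
    points of \<open>x\<close>; one such \<open>S\<close> between \<open>1\<close> and
    \<open>T\<close> serves for the whole sequence.\<close>
  obtain S where S: "1 < S" "S < T" "isCont x S"
    using cadlag_continuity_point[OF x _ T] by auto
  have "conv S xs x" using xs S by (simp add: halfline_conv_def)
  moreover have "bounded_upto S c x" using b S by (simp add: bounded_upto_def)
  moreover have "(r - c) / 2 > 0" using c by simp
  ultimately have "\<forall>\<^sub>F n in sequentially. bounded_upto S (c + (r - c) / 2) (xs n)"
    using assms x unfolding preserves_bounds_def by blast
  then show "\<forall>\<^sub>F n in sequentially. xs n \<in> paths_bounded_past_1 r"
  proof eventually_elim
    case (elim n)
    moreover have "c + (r - c) / 2 < r" using c by (simp add: field_simps)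
    ultimately show ?case using xs S unfolding paths_bounded_past_1_def by blast
  qed
qed

text \<open>Every cadlag path is bounded on \<open>[0, 2]\<close>, so the sets for growing
  \<open>j\<close> are an increasing open cover of the whole space, and a compact set lies in one of
  them.\<close>

lemma compactin_bounded:
  fixes conv :: "real \<Rightarrow> (nat \<Rightarrow> real \<Rightarrow> 'a::real_normed_vector) \<Rightarrow> (real \<Rightarrow> 'a) \<Rightarrow> bool"
  assumes conv: "preserves_bounds conv" and K: "compactin (cadlag_topology conv) K"
  obtains j :: nat where "K \<subseteq> paths_bounded_past_1 (real j)"
proof -
  let ?U = "\<lambda>j::nat. paths_bounded_past_1 (real j) :: (real \<Rightarrow> 'a) set"
  have "K \<subseteq> cadlag" using compactin_subset_topspace[OF K] by simp
  moreover have "cadlag \<subseteq> (\<Union>j. ?U j)"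
  proof
    fix x :: "real \<Rightarrow> 'a" assume x: "x \<in> cadlag"
    obtain c where c: "bounded_upto 2 c x" using cadlag_bounded[OF x] by blast
    obtain j :: nat where "c < real j" using reals_Archimedean2 by blast
    moreover have "(1::real) < 2" by simp
    ultimately have "x \<in> ?U j" using x c unfolding paths_bounded_past_1_def by blast
    then show "x \<in> (\<Union>j. ?U j)" by blast
  qed
  ultimately have "K \<subseteq> \<Union>(range ?U)" by blast
  moreover have "\<forall>U\<in>range ?U. openin (cadlag_topology conv) U"
    using openin_paths_bounded_past_1[OF conv] by blast
  ultimately obtain F where "finite F" "F \<subseteq> range ?U" "K \<subseteq> \<Union>F"
    using K unfolding compactin_def by meson
  then obtain J where J: "finite J" "K \<subseteq> (\<Union>j\<in>J. ?U j)"
    by (metis finite_subset_image)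
  have "?U j \<subseteq> ?U (Max J)" if "j \<in> J" for j
  proof -
    have "real j \<le> real (Max J)" using Max_ge[OF J(1) that] by simp
    then show ?thesis unfolding paths_bounded_past_1_def by (blast intro: order.strict_trans2)
  qed
  then show ?thesis using J that[of "Max J"] by blast
qed

section \<open>Step paths\<close>

definition step_path :: "real \<Rightarrow> (nat \<Rightarrow> 'a) \<Rightarrow> real \<Rightarrow> 'a::real_normed_vector" where
  "step_path r v = (\<lambda>t\<in>{0..}. v (nat \<lfloor>r * t\<rfloor>))"

lemma step_path_eq:
  assumes "real k \<le> r * t" "r * t < real k + 1" "0 \<le> t"
  shows "step_path r v t = v k"
proof -
  have "\<lfloor>r * t\<rfloor> = int k" using assms by (intro floor_unique) auto
  then show ?thesis using assms(3) by (simp add: step_path_def)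
qed

lemma step_path_left:
  assumes r: "r > 0" and t: "t > 0" and k: "real k < r * t" "r * t \<le> real k + 1"
  shows "(step_path r v \<longlongrightarrow> v k) (at_left t)"
proof (rule tendsto_eventually)
  have "real k / r < t" using r k by (simp add: field_simps)
  moreover have "step_path r v s = v k" if "real k / r < s" "s < t" for s
  proof (rule step_path_eq)
    show "real k \<le> r * s" using that(1) r by (simp add: field_simps)
    have "r * s < r * t" using that(2) r by simp
    then show "r * s < real k + 1" using k by simp
    show "0 \<le> s" using that(1) r by (smt (verit) divide_nonneg_pos of_nat_0_le_iff)
  qed
  ultimately show "\<forall>\<^sub>F s in at_left t. step_path r v s = v k"
    by (auto simp: eventually_at_left_field)
qed

lemma step_path_right:
  assumes r: "r > 0" and t: "t \<ge> 0"
  shows "(step_path r v \<longlongrightarrow> step_path r v t) (at_right t)"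
proof (rule tendsto_eventually)
  define k where "k = nat \<lfloor>r * t\<rfloor>"
  have rt: "r * t \<ge> 0" using r t by simp
  then have k: "real k \<le> r * t" "r * t < real k + 1" by (auto simp: k_def)
  then have "t < (real k + 1) / r" using r by (simp add: field_simps)
  moreover have "step_path r v s = step_path r v t" if "t < s" "s < (real k + 1) / r" for s
  proof -
    have "r * t < r * s" using that(1) r by simp
    moreover have "r * s < real k + 1" using that(2) r by (simp add: field_simps)
    ultimately have "step_path r v s = v k" using that k t by (intro step_path_eq) linarith+
    also have "\<dots> = step_path r v t" using k t by (intro step_path_eq[symmetric])
    finally show ?thesis .
  qed
  ultimately show "\<forall>\<^sub>F s in at_right t. step_path r v s = step_path r v t"
    by (auto simp: eventually_at_right_field)
qed

text \<open>The left limit at \<open>t\<close> is the value on the step whose interval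
  \<open>(k / r, (k + 1) / r]\<close> contains \<open>t\<close>; its index comes from the ceiling,
  that of the value at \<open>t\<close> from the floor.\<close>

lemma ceiling_pred:
  assumes "r * t > 0" 
  shows "real (nat \<lceil>r * t\<rceil> - 1) < r * t" "r * t \<le> real (nat \<lceil>r * t\<rceil> - 1) + 1"
proof -
  have "int (nat \<lceil>r * t\<rceil> - 1) = \<lceil>r * t\<rceil> - 1" using assms by (simp add: of_nat_diff Suc_le_eq)
  then have "real (nat \<lceil>r * t\<rceil> - 1) = real_of_int \<lceil>r * t\<rceil> - 1"
    by (metis of_int_1 of_int_diff of_int_of_nat_eq)
  then show "real (nat \<lceil>r * t\<rceil> - 1) < r * t" "r * t \<le> real (nat \<lceil>r * t\<rceil> - 1) + 1"
    by linarith+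
qed

lemma step_path_cadlag: "r > 0 \<Longrightarrow> step_path r v \<in> cadlag"
  unfolding cadlag_def
proof (intro CollectI conjI allI impI)
  show "step_path r v \<in> extensional {0..}" by (simp add: step_path_def)
  show "(step_path r v \<longlongrightarrow> step_path r v t) (at_right t)" if "r > 0" "0 \<le> t" for t
    using that by (rule step_path_right)
  show "\<exists>l. (step_path r v \<longlongrightarrow> l) (at_left t)" if "r > 0" "0 < t" for t
    using step_path_left[OF that ceiling_pred] that by auto
qed

lemma left_limit_step_path:
  assumes "r > 0" "t > 0" "real k < r * t" "r * t \<le> real k + 1"
  shows "left_limit (step_path r v) t = v k"
  using tendsto_Lim[OF _ step_path_left[OF assms, of v]] assms(2) by (simp add: left_limit_def)

lemma left_limit_step_path_0: "left_limit (step_path r v) 0 = v 0"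
  by (simp add: left_limit_def step_path_def)

section \<open>Parametrizing the completed graph of a step path\<close>

definition clip :: "real \<Rightarrow> real" where "clip s = max 0 (min 1 s)"

lemma clip_simps [simp]: "s \<le> 0 \<Longrightarrow> clip s = 0" "1 \<le> s \<Longrightarrow> clip s = 1"
  "0 \<le> s \<Longrightarrow> s \<le> 1 \<Longrightarrow> clip s = s"
  by (auto simp: clip_def)

lemma clip_mono: "s \<le> t \<Longrightarrow> clip s \<le> clip t" and clip_nonneg: "0 \<le> clip s"
  by (auto simp: clip_def)

lemma continuous_on_clip [continuous_intros]: "continuous_on S f \<Longrightarrow> continuous_on S (\<lambda>s. clip (f s))"
  unfolding clip_def by (intro continuous_intros)

text \<open>Terms before \<open>i\<close> have run to completion and terms after \<open>i\<close>
  have not begun. The range of \<open>s\<close> starts at \<open>2 * i - 1\<close> to serve both the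
  clock \<open>s\<close> of the time and the clock \<open>s - 1\<close> of the position.\<close>

lemma sum_clip:
  fixes d :: "nat \<Rightarrow> 'a::real_normed_vector"
  assumes "i \<le> N" "2 * real i \<le> s + 1" "s \<le> 2 * real i + 2"
  shows "(\<Sum>k\<le>N. clip (s - 2 * real k) *\<^sub>R d k) = (\<Sum>k<i. d k) + clip (s - 2 * real i) *\<^sub>R d i"
proof -
  have "{..N} = {..<i} \<union> {i} \<union> {i<..N}" using assms(1) by auto
  then have "(\<Sum>k\<le>N. clip (s - 2 * real k) *\<^sub>R d k) = (\<Sum>k<i. clip (s - 2 * real k) *\<^sub>R d k)
      + clip (s - 2 * real i) *\<^sub>R d i + (\<Sum>k\<in>{i<..N}. clip (s - 2 * real k) *\<^sub>R d k)"
    by (simp only:) (subst sum.union_disjoint; auto)+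
  also have "(\<Sum>k<i. clip (s - 2 * real k) *\<^sub>R d k) = (\<Sum>k<i. d k)"
    using assms by (intro sum.cong refl) auto
  also have "(\<Sum>k\<in>{i<..N}. clip (s - 2 * real k) *\<^sub>R d k) = 0"
    using assms by (intro sum.neutral) auto
  finally show ?thesis by simp
qed

text \<open>In the parametrization of the completed graph of a step path, the time runs from \<open>k / r\<close> to
  \<open>(k+1) / r\<close> during the parameter interval \<open>[2k, 2k+1]\<close>, and the jump from \<open>v k\<close> to \<open>v (k+1)\<close> takes
  place during \<open>[2k+1, 2k+2]\<close>.\<close>

definition graph_time :: "real \<Rightarrow> nat \<Rightarrow> real \<Rightarrow> real" where
  "graph_time r N s = (\<Sum>k\<le>N. clip (s - 2 * real k)) / r"

definition graph_pos :: "nat \<Rightarrow> (nat \<Rightarrow> 'a::real_normed_vector) \<Rightarrow> real \<Rightarrow> 'a" where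
  "graph_pos N v s = v 0 + (\<Sum>k\<le>N. clip (s - 1 - 2 * real k) *\<^sub>R (v (Suc k) - v k))"

text \<open>The parameter length \<open>real N + r * T\<close> consists of \<open>N\<close> full
  runs and \<open>N\<close> jumps, each of length \<open>1\<close>, and of the last run, cut off at
  time \<open>T\<close>, of length \<open>r * T - real N\<close>.\<close>

definition step_rep :: "real \<Rightarrow> real \<Rightarrow> (nat \<Rightarrow> 'a::real_normed_vector) \<Rightarrow> real \<Rightarrow> 'a \<times> real" where
  "step_rep T r v u = (let N = nat \<lfloor>r * T\<rfloor>; s = (real N + r * T) * u in (graph_pos N v s, graph_time r N s))"

lemma graph_time_eq:
  assumes "i \<le> N" "2 * real i \<le> s" "s \<le> 2 * real i + 2"
  shows "graph_time r N s = (real i + clip (s - 2 * real i)) / r"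
  using sum_clip[of i N s "\<lambda>_. 1 :: real"] assms by (simp add: graph_time_def)

lemma graph_pos_eq:
  assumes "i \<le> N" "2 * real i \<le> s" "s \<le> 2 * real i + 2"
  shows "graph_pos N v s = v i + clip (s - 1 - 2 * real i) *\<^sub>R (v (Suc i) - v i)"
  using sum_clip[of i N "s - 1" "\<lambda>k. v (Suc k) - v k"] assms
  by (simp add: graph_pos_def sum_lessThan_telescope)

lemma graph_cases:
  assumes r: "r > 0" and T: "T > 0" and N: "N = nat \<lfloor>r * T\<rfloor>" and s: "0 \<le> s" "s \<le> real N + r * T"
  obtains (run) i where "i \<le> N" "2 * real i \<le> s" "s < 2 * real i + 1"
      "graph_time r N s = (s - real i) / r" "graph_pos N v s = v i"
  | (jump) i where "i < N" "2 * real i + 1 \<le> s" "s < 2 * real i + 2"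
      "graph_time r N s = (real i + 1) / r"
      "graph_pos N v s = v i + (s - 1 - 2 * real i) *\<^sub>R (v (Suc i) - v i)"
proof -
  have rT: "real N \<le> r * T" "r * T < real N + 1" using r T by (auto simp: N)
  define i where "i = nat \<lfloor>s / 2\<rfloor>"
  have i: "2 * real i \<le> s" "s < 2 * real i + 2"
    using s(1) unfolding i_def by (simp, linarith)+
  have iN: "i \<le> N" using i s rT by linarith
  show ?thesis
  proof (cases "s < 2 * real i + 1")
    case True
    show ?thesis
    proof (rule run[OF iN i(1) True])
      show "graph_time r N s = (s - real i) / r"
        using graph_time_eq[OF iN i(1), of r] i True by simp
      show "graph_pos N v s = v i"
        using graph_pos_eq[OF iN i(1), of v] i True by simp
    qed
  next
    case False
    show ?thesis
    proof (rule jump[of i])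
      show "i < N" using False s rT iN by linarith
      show "2 * real i + 1 \<le> s" using False by simp
      show "graph_time r N s = (real i + 1) / r"
        using graph_time_eq[OF iN i(1), of r] i False by simp
      show "graph_pos N v s = v i + (s - 1 - 2 * real i) *\<^sub>R (v (Suc i) - v i)"
        using graph_pos_eq[OF iN i(1), of v] i False by simp
    qed (rule i)
  qed
qed

lemma graph_time_mono: "r > 0 \<Longrightarrow> s \<le> s' \<Longrightarrow> graph_time r N s \<le> graph_time r N s'"
  unfolding graph_time_def by (intro divide_right_mono sum_mono clip_mono) auto

text \<open>The index \<open>k\<close> depends on \<open>t\<close> only, so the distance to the left limit increases with \<open>s\<close> as long as
  the time stands still.\<close>

lemma graph_pos_diff:
  assumes r: "r > 0" and T: "T > 0" and N: "N = nat \<lfloor>r * T\<rfloor>" and s: "0 \<le> s" "s \<le> real N + r * T"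
    and t: "t = graph_time r N s" and k: "k = nat \<lceil>r * t\<rceil>"
  shows "graph_pos N v s - left_limit (step_path r v) t = clip (s + 1 - 2 * real k) *\<^sub>R (v k - v (k - 1))"
  using r T N s
proof (cases rule: graph_cases[where v = v])
  case (run i)
  then have rt: "r * t = s - real i" using r t by simp
  show ?thesis
  proof (cases "s = 2 * real i")
    \<comment> \<open>At \<open>s = 2 * i\<close> the jump into \<open>v i\<close> has just been
      completed, so for \<open>i > 0\<close> the left limit is still \<open>v (i - 1)\<close> and
      the factor is \<open>clip 1\<close>.\<close>
    case True
    then have k: "k = i" using k rt by simp
    show ?thesis
    proof (cases "i = 0")
      case True
      then have "t = 0" using rt \<open>s = _\<close> r by simp
      then show ?thesis using run k True by (simp add: left_limit_step_path_0)
    next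
      case False
      then have "t > 0" using rt True r by (metis add_diff_cancel_left' mult_2 of_nat_0_less_iff bot_nat_0.not_eq_extremum zero_less_mult_pos)
      then have "left_limit (step_path r v) t = v (i - 1)"
        using False rt True r by (intro left_limit_step_path) (auto simp: of_nat_diff)
      then show ?thesis using run k True by simp
    qed
  next
    case False
    then have s: "2 * real i < s" using run by simp
    have "\<lceil>r * t\<rceil> = int i + 1" using s run rt by (intro ceiling_unique) auto
    then have k: "k = Suc i" using k by simp
    have "r * t > 0" using rt s by simp
    then have "t > 0" using r by (simp add: zero_less_mult_iff)
    then have "left_limit (step_path r v) t = v i"
      using r rt s run by (intro left_limit_step_path) auto
    then show ?thesis using run k by simp
  qed
next
  case (jump i)
  then have rt: "r * t = real i + 1" using r t by simp
  then have "r * t = of_int (int i + 1)" by simp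
  then have "\<lceil>r * t\<rceil> = int i + 1" by (simp only: ceiling_of_int)
  then have k: "k = Suc i" using k by simp
  have "t > 0" using t jump r by simp
  then have "left_limit (step_path r v) t = v i"
    using r rt by (intro left_limit_step_path) auto
  then show ?thesis using jump k by (simp add: algebra_simps)
qed

text \<open>M1 convergence asks for parametric representations of all paths in the sequence; for
  step paths this explicit one serves, and it depends on finitely many values of the path
  only.\<close>

lemma parametric_rep_step:
  fixes v :: "nat \<Rightarrow> 'a::real_normed_vector"
  assumes r: "r > 0" and T: "T > 0"
  shows "parametric_rep T (step_path r v) (step_rep T r v)"
proof -
  define N where "N = nat \<lfloor>r * T\<rfloor>"
  define U where "U = real N + r * T"
  have rT: "real N \<le> r * T" "r * T < real N + 1" using r T by (auto simp: N_def)
  have U: "U > 0" using r T by (simp add: U_def add_nonneg_pos)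
  have rep: "step_rep T r v u = (graph_pos N v (U * u), graph_time r N (U * u))" for u
    by (simp add: step_rep_def N_def U_def Let_def)
  have Uu: "0 \<le> U * u" "U * u \<le> real N + r * T" if "u \<in> {0..1}" for u
    using that U unfolding U_def[symmetric] by (auto intro: mult_left_le)
  have sub: "(graph_pos N v s, graph_time r N s) \<in> completed_graph T (step_path r v)"
    if s: "0 \<le> s" "s \<le> real N + r * T" for s
    using r T N_def s
  proof (cases rule: graph_cases[where v = v])
    case (run i)
    define t where "t = graph_time r N s"
    have rt: "r * t = s - real i" using run r by (simp add: t_def)
    have "r * t \<le> r * T" 
    proof (cases "i = N")
      case True
      then show ?thesis using run s rt by simp
    next
      case False
      then have "real i + 1 \<le> real N" using run by linarith
      then show ?thesis using run rt rT by linarith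
    qed
    then have "t \<le> T" using r by simp
    moreover have "t \<ge> 0" using run r by (simp add: t_def)
    moreover from this have "step_path r v t = v i"
      using rt run by (intro step_path_eq) auto
    ultimately show ?thesis using run by (simp add: completed_graph_def t_def)
  next
    case (jump i)
    define t where "t = graph_time r N s"
    have rt: "r * t = real i + 1" using jump r by (simp add: t_def)
    have t: "t > 0" using jump r by (simp add: t_def)
    have "r * t \<le> r * T" using jump rT rt by linarith
    then have "t \<le> T" using r by simp
    moreover have "step_path r v t = v (Suc i)" using t rt by (intro step_path_eq) auto
    moreover have "left_limit (step_path r v) t = v i" using t rt r by (intro left_limit_step_path) auto
    moreover have "v i + (s - 1 - 2 * real i) *\<^sub>R (v (Suc i) - v i) \<in> closed_segment (v i) (v (Suc i))"
    proof -
      have "x + l *\<^sub>R (y - x) = (1 - l) *\<^sub>R x + l *\<^sub>R y" for l and x y :: 'a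
        by (simp add: algebra_simps)
      then show ?thesis unfolding in_segment using jump by (intro exI[of _ "s - 1 - 2 * real i"]) auto
    qed
    ultimately show ?thesis using jump t by (simp add: completed_graph_def t_def)
  qed
  have sup: "\<exists>s. 0 \<le> s \<and> s \<le> U \<and> (graph_pos N v s, graph_time r N s) = (z, t)"
    if zt: "(z, t) \<in> completed_graph T (step_path r v)" for z t
  proof -
    have t: "0 \<le> t" "t \<le> T" and z: "z \<in> closed_segment (left_limit (step_path r v) t) (step_path r v t)"
      using zt by (auto simp: completed_graph_def)
    define k where "k = nat \<lfloor>r * t\<rfloor>"
    have "r * t \<ge> 0" "r * t \<le> r * T" using r t by auto
    then have k: "real k \<le> r * t" "r * t < real k + 1" by (auto simp: k_def)
    have kN: "k \<le> N" unfolding k_def N_def using \<open>r * t \<le> r * T\<close> by (intro nat_mono floor_mono)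
    have x: "step_path r v t = v k" using k t by (intro step_path_eq) auto
    show ?thesis
    proof (cases "r * t = real k \<and> k > 0")
      case True
      then have tk: "t = real k / r" using r by (simp add: field_simps)
      then have "t > 0" using True r by simp
      then have l: "left_limit (step_path r v) t = v (k - 1)"
        using True r by (intro left_limit_step_path) (auto simp: of_nat_diff)
      obtain u where u: "0 \<le> u" "u \<le> 1" "z = (1 - u) *\<^sub>R v (k - 1) + u *\<^sub>R v k"
        using z unfolding x l in_segment by blast
      have k1: "real (k - 1) = real k - 1" "Suc (k - 1) = k" "k - 1 \<le> N" using True kN by (auto simp: of_nat_diff)
      \<comment> \<open>The jump into \<open>v k\<close> occupies the parameters from
        \<open>2 * k - 1\<close> to \<open>2 * k\<close>.\<close>
      let ?s = "2 * real k - 1 + u"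
      have "graph_pos N v ?s = v (k - 1) + u *\<^sub>R (v k - v (k - 1))"
        using graph_pos_eq[OF k1(3), of ?s v] u(1,2) k1 by simp
      also have "\<dots> = z" unfolding u(3) by (simp add: algebra_simps)
      finally have "graph_pos N v ?s = z" .
      moreover have "graph_time r N ?s = t"
        using graph_time_eq[OF k1(3), of ?s r] u k1 tk by simp
      moreover have "?s \<le> U" using u kN rT unfolding U_def by linarith
      moreover have "?s \<ge> 0" using u True by linarith
      ultimately show ?thesis by blast
    next
      case False
      have l: "left_limit (step_path r v) t = v k"
      proof (cases "t = 0")
        case True
        then have "k = 0" by (simp add: k_def)
        then show ?thesis using True by (simp add: left_limit_step_path_0)
      next
        case nz: False
        then have "r * t > 0" using t r by simp
        then have "real k < r * t" using False k by (cases "k = 0") auto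
        then show ?thesis using nz t k r by (intro left_limit_step_path) auto
      qed
      then have "z = v k" using z x by simp
      \<comment> \<open>During run \<open>k\<close> the time at parameter \<open>s\<close> is
        \<open>(s - k) / r\<close>.\<close>
      let ?s = "real k + r * t"
      have "graph_pos N v ?s = z"
        using graph_pos_eq[OF kN, of ?s v] k \<open>z = v k\<close> by simp
      moreover have "graph_time r N ?s = t"
        using graph_time_eq[OF kN, of ?s r] k r by simp
      moreover have "?s \<le> U" using kN \<open>r * t \<le> r * T\<close> unfolding U_def by linarith
      moreover have "?s \<ge> 0" using k by linarith
      ultimately show ?thesis by blast
    qed
  qed
  show ?thesis
    unfolding parametric_rep_def
  proof (intro conjI ballI impI)
    show "continuous_on {0..1} (step_rep T r v)"
      unfolding rep graph_pos_def graph_time_def using r by (intro continuous_intros) auto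
    show "step_rep T r v ` {0..1} = completed_graph T (step_path r v)"
    proof (intro equalityI subsetI)
      fix p assume "p \<in> step_rep T r v ` {0..1}"
      then show "p \<in> completed_graph T (step_path r v)" using sub Uu by (auto simp: rep)
    next
      fix p assume p: "p \<in> completed_graph T (step_path r v)"
      obtain z t where zt: "p = (z, t)" by fastforce
      obtain s where s: "0 \<le> s" "s \<le> U" "(graph_pos N v s, graph_time r N s) = (z, t)"
        using sup p zt by blast
      have "p = step_rep T r v (s / U)" using s U zt by (simp add: rep)
      moreover have "s / U \<in> {0..1}" using s U by simp
      ultimately show "p \<in> step_rep T r v ` {0..1}" by blast
    qed
  next
    fix u u' :: real assume u: "u \<in> {0..1}" "u' \<in> {0..1}" "u \<le> u'"
    let ?t = "graph_time r N (U * u)" and ?t' = "graph_time r N (U * u')"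
    have le: "U * u \<le> U * u'" using u U by simp
    have "?t \<le> ?t'" using r le by (rule graph_time_mono)
    moreover have "norm (graph_pos N v (U * u) - left_limit (step_path r v) ?t) \<le>
        norm (graph_pos N v (U * u') - left_limit (step_path r v) ?t)" if "?t = ?t'"
    proof -
      let ?k = "nat \<lceil>r * ?t\<rceil>"
      have "graph_pos N v (U * u) - left_limit (step_path r v) ?t =
          clip (U * u + 1 - 2 * real ?k) *\<^sub>R (v ?k - v (?k - 1))"
        using Uu[OF u(1)] by (intro graph_pos_diff[OF r T N_def]) auto
      moreover have "graph_pos N v (U * u') - left_limit (step_path r v) ?t =
          clip (U * u' + 1 - 2 * real ?k) *\<^sub>R (v ?k - v (?k - 1))"
        using Uu[OF u(2)] that by (intro graph_pos_diff[OF r T N_def]) auto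
      moreover have "clip (U * u + 1 - 2 * real ?k) \<le> clip (U * u' + 1 - 2 * real ?k)"
        using le by (intro clip_mono) simp
      ultimately show ?thesis by (simp add: clip_nonneg mult_right_mono)
    qed
    ultimately show "graph_le (step_path r v) (step_rep T r v u) (step_rep T r v u')"
      by (auto simp: graph_le_def rep)
  qed
qed

section \<open>Convergence of step paths in the four modes\<close>

definition step_continuous ::
  "(real \<Rightarrow> (nat \<Rightarrow> real \<Rightarrow> 'a::real_normed_vector) \<Rightarrow> (real \<Rightarrow> 'a) \<Rightarrow> bool) \<Rightarrow> bool" where
  "step_continuous conv \<longleftrightarrow> (\<forall>r T vs v. r > 0 \<longrightarrow> T > 0 \<longrightarrow> (\<forall>k. \<forall>\<^sub>F m in sequentially. vs m k = v k) \<longrightarrow>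
     conv T (\<lambda>m. step_path r (vs m)) (step_path r v))"

text \<open>Weaker modes inherit this property, in the opposite direction to
  \<open>preserves_bounds_mono\<close>; here J1 and M1 are the ones to be treated directly.\<close>

lemma step_continuous_mono:
  assumes "\<And>T xs x. conv T xs x \<Longrightarrow> conv' T xs x" and "step_continuous conv"
  shows "step_continuous conv'"
  unfolding step_continuous_def
  by (intro allI impI assms(1) assms(2)[unfolded step_continuous_def, rule_format]) auto

lemma eventually_agree_upto:
  fixes K :: nat
  assumes "\<forall>k. \<forall>\<^sub>F m in sequentially. vs m k = v k"
  shows "\<forall>\<^sub>F m in sequentially. \<forall>k\<in>{..K}. vs m k = v k"
  using assms by (intro eventually_ball_finite) auto

lemma step_continuous_J1: "step_continuous J1_conv"
  unfolding step_continuous_def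
proof (intro allI impI)
  fix r T :: real and vs and v :: "nat \<Rightarrow> 'a"
  assume r: "r > 0" and "T > 0" and agree: "\<forall>k. \<forall>\<^sub>F m in sequentially. vs m k = v k"
  have "uniform_limit {0..T} (\<lambda>m t. step_path r (vs m) t - step_path r v t) (\<lambda>t. 0) sequentially"
    unfolding uniform_limit_iff
  proof (intro allI impI)
    fix e :: real assume "e > 0"
    \<comment> \<open>The path on \<open>{0..T}\<close> depends on these values only, so the
      identity time change works.\<close>
    from eventually_agree_upto[OF agree, of "nat \<lfloor>r * T\<rfloor>"]
    show "\<forall>\<^sub>F m in sequentially. \<forall>t\<in>{0..T}. dist (step_path r (vs m) t - step_path r v t) 0 < e"
    proof eventually_elim
      case (elim m)
      have "nat \<lfloor>r * t\<rfloor> \<in> {..nat \<lfloor>r * T\<rfloor>}" if "t \<in> {0..T}" for t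
        using that r by (auto intro!: nat_mono floor_mono)
      then have "step_path r (vs m) t = step_path r v t" if "t \<in> {0..T}" for t
        using elim that by (auto simp: step_path_def)
      then show ?case using \<open>e > 0\<close> by simp
    qed
  qed
  then show "J1_conv T (\<lambda>m. step_path r (vs m)) (step_path r v)"
    unfolding J1_conv_def
    by (intro exI[of _ "\<lambda>_ t. t"]) (auto simp: strict_mono_on_def bij_betw_def uniform_limit_const)
qed

lemma step_continuous_J2: "step_continuous J2_conv"
  using J1_conv_imp_J2_conv step_continuous_J1 by (rule step_continuous_mono)

lemma step_continuous_M1: "step_continuous M1_conv"
  unfolding step_continuous_def
proof (intro allI impI)
  fix r T :: real and vs and v :: "nat \<Rightarrow> 'a"
  assume r: "r > 0" and T: "T > 0" and agree: "\<forall>k. \<forall>\<^sub>F m in sequentially. vs m k = v k"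
  have "uniform_limit {0..1} (\<lambda>m. step_rep T r (vs m)) (step_rep T r v) sequentially"
    unfolding uniform_limit_iff
  proof (intro allI impI)
    fix e :: real assume "e > 0"
    \<comment> \<open>One index more than for J1, because the formula for \<open>graph_pos\<close>
      mentions \<open>v (Suc N)\<close>.\<close>
    from eventually_agree_upto[OF agree, of "Suc (nat \<lfloor>r * T\<rfloor>)"]
    show "\<forall>\<^sub>F m in sequentially. \<forall>u\<in>{0..1}. dist (step_rep T r (vs m) u) (step_rep T r v u) < e"
    proof eventually_elim
      case (elim m)
      then have "step_rep T r (vs m) u = step_rep T r v u" for u
        by (auto simp: step_rep_def graph_pos_def Let_def intro!: sum.cong)
      then show ?case using \<open>e > 0\<close> by simp
    qed
  qed
  then show "M1_conv T (\<lambda>m. step_path r (vs m)) (step_path r v)"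
    unfolding M1_conv_def
    by (intro exI[of _ "\<lambda>m. step_rep T r (vs m)"] exI[of _ "step_rep T r v"] conjI allI
        parametric_rep_step r T)
qed

lemma step_continuous_M2: "step_continuous M2_conv"
  using M1_conv_imp_M2_conv step_continuous_M1 by (rule step_continuous_mono)

lemma step_path_eventually_in_open:
  assumes conv: "step_continuous conv" and U: "openin (cadlag_topology conv) U"
    and "r > 0" "step_path r v \<in> U" "\<forall>k. \<forall>\<^sub>F m in sequentially. vs m k = v k"
  shows "\<forall>\<^sub>F m in sequentially. step_path r (vs m) \<in> U"
proof -
  have "halfline_conv conv (\<lambda>m. step_path r (vs m)) (step_path r v)"
    unfolding halfline_conv_def
    by (intro allI impI conv[unfolded step_continuous_def, rule_format] assms(3) assms(5)[rule_format])
  then show ?thesis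
    by (intro U[unfolded openin_cadlag_topology, THEN conjunct2, rule_format, OF assms(4)]
        conjI allI step_path_cadlag assms(3))
qed

section \<open>Large maxima and failure of tightness\<close>

text \<open>The cutoff \<open>k0\<close> is about \<open>R ^ 3\<close>: then the first term is of
  order \<open>1 / R\<close>, while \<open>ln k0\<close> stays comparable to \<open>ln R\<close>.
  The \<open>+ 1\<close> and \<open>- 1\<close> absorb the rounding of \<open>R ^ 3\<close> and
  \<open>s\<close>.\<close>

lemma avoid_floor_le:
  assumes "norm (real_point x) \<le> R" "R \<ge> 1" "s \<ge> 3" "R ^ 3 + 1 \<le> s - 1"
  shows "avoid (Suc (2 * nat \<lfloor>s\<rfloor>)) x \<le> (R + 1)\<^sup>2 / (2 * R ^ 3) + 4 * (2 + ln (R ^ 3 + 1)) / ln (s - 1)"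
proof -
  define k0 where "k0 = nat \<lceil>R ^ 3\<rceil>"
  have R3: "R ^ 3 \<ge> 1" using assms(2) by simp
  then have k0: "R ^ 3 \<le> real k0" "real k0 \<le> R ^ 3 + 1" unfolding k0_def by linarith+
  have m: "s - 1 \<le> real (nat \<lfloor>s\<rfloor>)" using assms(3) by linarith
  have "avoid (Suc (2 * nat \<lfloor>s\<rfloor>)) x \<le>
      (R + 1)\<^sup>2 / (2 * real k0) + 4 * (2 + ln (real k0)) / ln (real (nat \<lfloor>s\<rfloor>))"
  proof (rule avoid_le[OF assms(1)])
    show "0 < k0" using k0 R3 by linarith
    have "real k0 \<le> real (nat \<lfloor>s\<rfloor>)" using k0 m assms(4) by linarith
    then show "k0 \<le> nat \<lfloor>s\<rfloor>" by simp
    show "1 < nat \<lfloor>s\<rfloor>" using m assms(3) by linarith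
  qed
  also have "\<dots> \<le> (R + 1)\<^sup>2 / (2 * R ^ 3) + 4 * (2 + ln (R ^ 3 + 1)) / ln (s - 1)"
  proof (intro add_mono frac_le)
    have "0 < real k0" using k0 R3 by linarith
    then show "4 * (2 + ln (real k0)) \<le> 4 * (2 + ln (R ^ 3 + 1))" using k0 by simp
    show "ln (s - 1) \<le> ln (real (nat \<lfloor>s\<rfloor>))" using m assms(3) by simp
    have "0 \<le> ln (R ^ 3 + 1)" using R3 by (intro ln_ge_zero) linarith
    then show "0 \<le> 4 * (2 + ln (R ^ 3 + 1))" by (intro mult_nonneg_nonneg add_nonneg_nonneg) auto
  qed (use k0 R3 assms in auto)
  finally show ?thesis .
qed

context perturbed_random_walk
begin

lemma large_maximum:
  assumes a: "a > 0"
    and tail: "(\<lambda>t. \<P>(\<omega> in M. norm (real_point (X 1 \<omega>)) > t)) \<sim>[at_top] (\<lambda>t. a / ln (ln t))"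
  shows "\<forall>\<^sub>F n in sequentially.
    1 / 8 \<le> \<P>(\<omega> in M. \<exists>k\<in>{1..n}. norm (real_point (X k \<omega>)) > (real n)\<^sup>2)"
proof -
  define p where "p t = \<P>(\<omega> in M. norm (real_point (X 1 \<omega>)) > t)" for t :: real
  \<comment> \<open>\<open>ln (ln R)\<close> is half of \<open>ln (ln n)\<close>, so the tail at
    \<open>R\<close> has the same order as the tail at \<open>n ^ 2\<close>, whereas
    \<open>ln R\<close> is negligible against \<open>ln n\<close>.\<close>
  define R where "R = (\<lambda>n::nat. exp (sqrt (ln (real n))))"
  define s where "s = (\<lambda>n::nat. sqrt (real n))"
  define \<beta> where "\<beta> = (\<lambda>n. (R n + 1)\<^sup>2 / (2 * R n ^ 3) + 4 * (2 + ln (R n ^ 3 + 1)) / ln (s n - 1))"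
  \<comment> \<open>Eventually \<open>n * D n\<close> bounds the last factor in
    \<open>exit_prob\<close>, taken with
    \<open>m = Suc (2 * nat \<lfloor>s n\<rfloor>)\<close>.\<close>
  define D where "D = (\<lambda>n. (2 * s n + 2) / real n + (3 / 2 * (a / ln (ln (R n))) + \<beta> n))"
  \<comment> \<open>Asymptotic equivalence reads the quotient as \<open>1\<close> where both
    functions vanish; positivity turns it into an ordinary quotient.\<close>
  have pos: "\<forall>\<^sub>F t :: real in at_top. a / ln (ln t) > 0" using a by real_asymp
  have "((\<lambda>t. p t / (a / ln (ln t))) \<longlongrightarrow> 1) at_top"
    using tail unfolding p_def[symmetric]
    by (rule asymp_equivD_strong) (use pos in \<open>auto elim: eventually_mono\<close>)
  from tendstoD[OF this, of "1 / 2"]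
  have "\<forall>\<^sub>F t in at_top. \<bar>p t / (a / ln (ln t)) - 1\<bar> < 1 / 2" by (simp add: dist_norm)
  with pos have tails: "\<forall>\<^sub>F t in at_top. a / ln (ln t) / 2 \<le> p t \<and> p t \<le> 3 / 2 * (a / ln (ln t))"
  proof eventually_elim
    case (elim t)
    define y where "y = a / ln (ln t)"
    have "y > 0" "\<bar>p t / y - 1\<bar> < 1 / 2" using elim by (auto simp: y_def)
    then have "1 / 2 \<le> p t / y" "p t / y \<le> 3 / 2" by linarith+
    then show ?case unfolding y_def[symmetric] using \<open>y > 0\<close> by (simp add: field_simps)
  qed
  have "filterlim (\<lambda>n. (real n)\<^sup>2) at_top sequentially" by real_asymp
  from filterlim_iff[THEN iffD1, OF this, rule_format, OF tails]
  have lower: "\<forall>\<^sub>F n in sequentially. a / ln (ln ((real n)\<^sup>2)) / 2 \<le> p ((real n)\<^sup>2)"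
    by (rule eventually_mono) blast
  have "filterlim R at_top sequentially" unfolding R_def by real_asymp
  from filterlim_iff[THEN iffD1, OF this, rule_format, OF tails]
  have upper: "\<forall>\<^sub>F n in sequentially. p (R n) \<le> 3 / 2 * (a / ln (ln (R n)))"
    by (rule eventually_mono) blast
  have size: "\<forall>\<^sub>F n in sequentially. R n \<ge> 1 \<and> s n \<ge> 3 \<and> R n ^ 3 + 1 \<le> s n - 1 \<and> n \<ge> 1"
    unfolding R_def s_def by (intro eventually_conj) real_asymp+
  \<comment> \<open>The numerator is about \<open>a / (2 * ln (ln n))\<close> and \<open>D n\<close>
    is about \<open>3 / 2 * (2 * a / ln (ln n))\<close>, where \<open>1 / 2\<close> and
    \<open>3 / 2\<close> come from the tail bounds; \<open>\<beta>\<close> and the first term of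
    \<open>D\<close> are of smaller order. Any bound below \<open>1 / 6\<close> can be extracted,
    such as \<open>1 / 8\<close>.\<close>
  have "(\<lambda>n. a / ln (ln ((real n)\<^sup>2)) / 2 / D n) \<longlonglongrightarrow> 1 / 6"
    unfolding D_def \<beta>_def R_def s_def using a by real_asymp
  from order_tendstoD(1)[OF this, of "1 / 8"]
  have ratio: "\<forall>\<^sub>F n in sequentially. 1 / 8 < a / ln (ln ((real n)\<^sup>2)) / 2 / D n" by simp
  have Dpos: "\<forall>\<^sub>F n in sequentially. D n > 0"
    unfolding D_def \<beta>_def R_def s_def using a by real_asymp
  have \<beta>pos: "\<forall>\<^sub>F n in sequentially. \<beta> n > 0"
    unfolding \<beta>_def R_def s_def by real_asymp
  from lower upper size ratio Dpos \<beta>pos show ?thesis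
  proof eventually_elim
    case (elim n)
    define P where "P = \<P>(\<omega> in M. \<exists>k\<in>{1..n}. norm (real_point (X k \<omega>)) > (real n)\<^sup>2)"
    have n: "real n > 0" using elim by simp
    have "real n * p ((real n)\<^sup>2) \<le> P * (real (Suc (2 * nat \<lfloor>s n\<rfloor>)) + 1 + real n * (p (R n) + \<beta> n))"
      unfolding p_def P_def
    proof (rule exit_prob)
      show "real n \<le> (real n)\<^sup>2" using elim by (simp add: power2_eq_square)
      show "avoid (Suc (2 * nat \<lfloor>s n\<rfloor>)) x \<le> \<beta> n" if "norm (real_point x) \<le> R n" for x
        unfolding \<beta>_def using elim that by (intro avoid_floor_le) auto
      show "0 \<le> \<beta> n" using elim by simp
    qed
    also have "\<dots> \<le> P * (real n * D n)"
    proof (rule mult_left_mono)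
      have "real (Suc (2 * nat \<lfloor>s n\<rfloor>)) + 1 \<le> 2 * s n + 2" using elim by simp
      moreover have "real n * (p (R n) + \<beta> n) \<le> real n * (3 / 2 * (a / ln (ln (R n))) + \<beta> n)"
        using elim by (intro mult_left_mono add_right_mono) auto
      moreover have "real n * D n = (2 * s n + 2) + real n * (3 / 2 * (a / ln (ln (R n))) + \<beta> n)"
        using n unfolding D_def by (simp only: distrib_left) simp
      ultimately show "real (Suc (2 * nat \<lfloor>s n\<rfloor>)) + 1 + real n * (p (R n) + \<beta> n) \<le> real n * D n"
        by linarith
    qed (simp add: P_def)
    finally have "real n * p ((real n)\<^sup>2) \<le> real n * (P * D n)" by (simp add: mult_ac)
    then have "p ((real n)\<^sup>2) \<le> P * D n" using n by simp
    then have "a / ln (ln ((real n)\<^sup>2)) / 2 \<le> P * D n" using elim by linarith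
    moreover have "D n > 0" using elim by simp
    ultimately have "a / ln (ln ((real n)\<^sup>2)) / 2 / D n \<le> P"
      by (rule pos_divide_le_eq[THEN iffD2, rotated])
    then show ?case unfolding P_def using elim by linarith
  qed
qed

section \<open>The scaled walk as a random path\<close>

lemma scaled_path_eq: "scaled_path n X \<omega> = step_path (real n) (\<lambda>k. (1 / real n) *\<^sub>R real_point (X k \<omega>))"
  by (simp add: scaled_path_def step_path_def)

text \<open>An open set of step paths is decided by finitely many values of the path: otherwise a step path in
  the set would be the limit of step paths outside it.\<close>

lemma measurable_scaled_path:
  assumes conv: "step_continuous conv" and n: "n \<ge> 1"
  shows "scaled_path n X \<in> measurable M (borel_of (cadlag_topology conv))"
  unfolding borel_of_def
proof (rule measurable_measure_of)
  show "{U. openin (cadlag_topology conv) U} \<subseteq> Pow (topspace (cadlag_topology conv))"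
    using openin_subset by blast
  show "scaled_path n X \<in> space M \<rightarrow> topspace (cadlag_topology conv)"
    using n by (simp add: scaled_path_eq step_path_cadlag)
  fix U assume "U \<in> {U. openin (cadlag_topology conv) U}"
  then have U: "openin (cadlag_topology conv) U" by simp
  let ?path = "\<lambda>z. step_path (real n) (\<lambda>k. (1 / real n) *\<^sub>R real_point (z k))"
  \<comment> \<open>All paths that begin with the values \<open>l\<close> lie in \<open>U\<close>;
    read as a condition on \<open>hist m\<close> this is an event, and the union over
    \<open>m\<close> is countable.\<close>
  let ?S = "\<lambda>m l. \<forall>z. map z [0..<Suc m] = l \<longrightarrow> ?path z \<in> U"
  have "scaled_path n X \<omega> \<in> U \<longleftrightarrow> (\<exists>m. ?S m (hist m \<omega>))" for \<omega>
  proof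
    assume "\<exists>m. ?S m (hist m \<omega>)"
    then show "scaled_path n X \<omega> \<in> U" unfolding scaled_path_eq hist_def by blast
  next
    assume in_U: "scaled_path n X \<omega> \<in> U"
    show "\<exists>m. ?S m (hist m \<omega>)"
    proof (rule ccontr)
      assume "\<not> (\<exists>m. ?S m (hist m \<omega>))"
      then have "\<forall>m. \<exists>z. map z [0..<Suc m] = hist m \<omega> \<and> ?path z \<notin> U" by blast
      then obtain z where z: "\<And>m. map (z m) [0..<Suc m] = hist m \<omega>" "\<And>m. ?path (z m) \<notin> U" by metis
      have "z m k = X k \<omega>" if "k \<le> m" for m k
      proof -
        have "map (z m) [0..<Suc m] ! k = z m k" using that by (simp add: less_Suc_eq_le del: upt_Suc)
        then show ?thesis using z(1) hist_nth[OF that] by simp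
      qed
      then have "\<forall>\<^sub>F m in sequentially. (1 / real n) *\<^sub>R real_point (z m k) = (1 / real n) *\<^sub>R real_point (X k \<omega>)" for k
        by (intro eventually_sequentiallyI[of k]) simp
      then have "\<forall>\<^sub>F m in sequentially. ?path (z m) \<in> U"
        using in_U n unfolding scaled_path_eq by (intro step_path_eventually_in_open[OF conv U]) auto
      then show False using z(2) by simp
    qed
  qed
  then have "scaled_path n X -` U \<inter> space M = {\<omega>\<in>space M. \<exists>m. ?S m (hist m \<omega>)}" by auto
  also have "\<dots> \<in> sets M" by measurable
  finally show "scaled_path n X -` U \<inter> space M \<in> sets M" .
qed

text \<open>A compact set consists of paths bounded by some \<open>j\<close> on
  \<open>[0, 1]\<close>. For \<open>n \<ge> j\<close> such a bound keeps the unscaled walk up to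
  time \<open>n\<close> within \<open>n * n\<close>, which fails with probability at least
  \<open>1 / 8\<close>.\<close>

lemma not_tight_scaled_path:
  assumes conv: "step_continuous conv" "preserves_bounds conv"
    and large: "\<forall>\<^sub>F n in sequentially.
      1 / 8 \<le> \<P>(\<omega> in M. \<exists>k\<in>{1..n}. norm (real_point (X k \<omega>)) > (real n)\<^sup>2)"
  shows "\<not> tight_family (cadlag_topology conv) {1..}
    (\<lambda>n. distr M (borel_of (cadlag_topology conv)) (scaled_path n X))"
proof
  let ?T = "cadlag_topology conv :: (real \<Rightarrow> real^2) topology"
  assume "tight_family ?T {1..} (\<lambda>n. distr M (borel_of ?T) (scaled_path n X))"
  \<comment> \<open>Any \<open>\<epsilon>\<close> below \<open>1 / 8\<close> contradicts the lower
    bound for the maximum.\<close>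
  moreover have "(1 / 16 :: real) > 0" by simp
  ultimately obtain K where K: "compactin ?T K"
    and mK: "\<And>n. n \<ge> 1 \<Longrightarrow> measure (distr M (borel_of ?T) (scaled_path n X)) K \<ge> 1 - 1 / 16"
    unfolding tight_family_def by (metis atLeast_iff)
  obtain j :: nat where j: "K \<subseteq> paths_bounded_past_1 (real j)"
    using compactin_bounded[OF conv(2) K] by blast
  let ?U = "paths_bounded_past_1 (real j) :: (real \<Rightarrow> real^2) set"
  have "\<forall>\<^sub>F n in sequentially. n \<ge> max 1 j" by (rule eventually_ge_at_top)
  with large have "\<forall>\<^sub>F n in sequentially. n \<ge> max 1 j \<and>
      1 / 8 \<le> \<P>(\<omega> in M. \<exists>k\<in>{1..n}. norm (real_point (X k \<omega>)) > (real n)\<^sup>2)"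
    by eventually_elim auto
  then obtain n where n: "n \<ge> 1" "n \<ge> j"
    and P: "1 / 8 \<le> \<P>(\<omega> in M. \<exists>k\<in>{1..n}. norm (real_point (X k \<omega>)) > (real n)\<^sup>2)"
    by (auto dest: eventually_happens)
  let ?\<mu> = "distr M (borel_of ?T) (scaled_path n X)"
  have meas: "scaled_path n X \<in> measurable M (borel_of ?T)"
    by (rule measurable_scaled_path[OF conv(1) n(1)])
  then interpret \<mu>: prob_space ?\<mu> by (rule prob_space_distr)
  \<comment> \<open>Only the open superset of \<open>K\<close> is known to be Borel. A set outside
    the sigma-algebra has \<open>measure\<close> zero, so the comparison with \<open>K\<close> holds
    in either case.\<close>
  have "?U \<in> sets (borel_of ?T)"
    using openin_paths_bounded_past_1[OF conv(2)] openin_subset[of ?T]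
    by (auto simp: borel_of_def sets_measure_of_conv)
  then have U: "measure ?\<mu> K \<le> measure ?\<mu> ?U" "measure ?\<mu> ?U = measure M (scaled_path n X -` ?U \<inter> space M)"
    using j meas by (auto intro!: \<mu>.finite_measure_mono measure_distr)
  let ?E = "{\<omega>\<in>space M. \<exists>k\<in>{1..n}. norm (real_point (X k \<omega>)) > (real n)\<^sup>2}"
  have "norm (real_point (X k \<omega>)) \<le> (real n)\<^sup>2" if in_U: "scaled_path n X \<omega> \<in> ?U" and k: "k \<in> {1..n}" for k \<omega>
  proof -
    obtain T c where T: "T > 1" "c < real j" "bounded_upto T c (scaled_path n X \<omega>)"
      using in_U by (auto simp: paths_bounded_past_1_def)
    have "real k / real n \<le> 1" using k n by simp
    then have t: "real k / real n \<in> {0..T}" using T(1) by simp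
    have "scaled_path n X \<omega> (real k / real n) = (1 / real n) *\<^sub>R real_point (X k \<omega>)"
      unfolding scaled_path_eq using n by (intro step_path_eq) auto
    moreover have "norm (scaled_path n X \<omega> (real k / real n)) \<le> c"
      using T(3) t by (simp add: bounded_upto_def)
    ultimately have "norm (real_point (X k \<omega>)) / real n \<le> c" by simp
    then have "norm (real_point (X k \<omega>)) \<le> c * real n" using n by (simp add: field_simps)
    also have "\<dots> \<le> real n * real n" using T(2) n by (intro mult_right_mono) auto
    finally show ?thesis by (simp add: power2_eq_square)
  qed
  then have "scaled_path n X -` ?U \<inter> space M \<subseteq> space M - ?E" by (force simp: not_less)
  then have "measure M (scaled_path n X -` ?U \<inter> space M) \<le> measure M (space M - ?E)"
    by (rule finite_measure_mono) measurable
  also have "\<dots> = 1 - measure M ?E" by (rule prob_compl) measurable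
  finally show False using P U mK[OF n(1)] by linarith
qed

end

theorem theorem2p2:
  fixes M :: "'w measure" and X :: "nat \<Rightarrow> 'w \<Rightarrow> int^2" and a :: real
  assumes "prob_space M"
    and "perturbed_walk M X"
    and "a > 0"
    and "(\<lambda>t::real. \<P>(\<omega> in M. norm (real_point (X 1 \<omega>)) > t)) \<sim>[at_top] (\<lambda>t. a / ln (ln t))"
  shows "liminf (\<lambda>n. ereal (\<P>(\<omega> in M. Max ((\<lambda>k. norm (real_point (X k \<omega>))) ` {1..n}) > real n))) > 0
    \<and> (\<forall>\<T> \<in> {J1_topology, J2_topology, M1_topology, M2_topology}.
         (\<forall>n\<ge>1. scaled_path n X \<in> measurable M (borel_of \<T>)) \<and>
         \<not> tight_family \<T> {1..} (\<lambda>n. distr M (borel_of \<T>) (scaled_path n X)))"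
proof (rule conjI)
  interpret prob_space M by fact
  interpret perturbed_random_walk M X by unfold_locales fact
  note large = large_maximum[OF assms(3,4)]
  have "\<forall>\<^sub>F n in sequentially.
      ereal (1 / 8) \<le> ereal (\<P>(\<omega> in M. Max ((\<lambda>k. norm (real_point (X k \<omega>))) ` {1..n}) > real n))"
    using large eventually_ge_at_top[of 1]
  proof eventually_elim
    case (elim n)
    \<comment> \<open>\<open>n \<ge> 1\<close> makes the set under \<open>Max\<close> nonempty; on
      the empty set \<open>Max\<close> is unspecified.\<close>
    have Max: "Max ((\<lambda>k. norm (real_point (X k \<omega>))) ` {1..n}) > real n \<longleftrightarrow>
        (\<exists>k\<in>{1..n}. norm (real_point (X k \<omega>)) > real n)" for \<omega>
      using elim(2) by (subst Max_gr_iff) auto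
    have "real n \<le> (real n)\<^sup>2" using elim(2) by (simp add: power2_eq_square)
    then have "\<exists>k\<in>{1..n}. norm (real_point (X k \<omega>)) > real n"
      if "\<exists>k\<in>{1..n}. norm (real_point (X k \<omega>)) > (real n)\<^sup>2" for \<omega>
      using that by (meson order.strict_trans1)
    then have "\<P>(\<omega> in M. \<exists>k\<in>{1..n}. norm (real_point (X k \<omega>)) > (real n)\<^sup>2) \<le>
        \<P>(\<omega> in M. \<exists>k\<in>{1..n}. norm (real_point (X k \<omega>)) > real n)"
      by (intro finite_measure_mono) auto
    then show ?case using elim(1) unfolding Max by simp
  qed
  then have "ereal (1 / 8) \<le> liminf (\<lambda>n. ereal (\<P>(\<omega> in M. Max ((\<lambda>k. norm (real_point (X k \<omega>))) ` {1..n}) > real n)))"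
    by (rule Liminf_bounded)
  then show "liminf (\<lambda>n. ereal (\<P>(\<omega> in M. Max ((\<lambda>k. norm (real_point (X k \<omega>))) ` {1..n}) > real n))) > 0"
    by (rule order.strict_trans2[rotated]) simp
  have "(\<forall>n\<ge>1. scaled_path n X \<in> measurable M (borel_of (cadlag_topology conv))) \<and>
      \<not> tight_family (cadlag_topology conv) {1..} (\<lambda>n. distr M (borel_of (cadlag_topology conv)) (scaled_path n X))"
    if "step_continuous conv" "preserves_bounds conv" for conv
    using measurable_scaled_path[OF that(1)] not_tight_scaled_path[OF that large] by blast
  note this[OF step_continuous_J1 preserves_bounds_J1] this[OF step_continuous_J2 preserves_bounds_J2]
    this[OF step_continuous_M1 preserves_bounds_M1] this[OF step_continuous_M2 preserves_bounds_M2]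
  then show "\<forall>\<T> \<in> {J1_topology, J2_topology, M1_topology, M2_topology}.
         (\<forall>n\<ge>1. scaled_path n X \<in> measurable M (borel_of \<T>)) \<and>
         \<not> tight_family \<T> {1..} (\<lambda>n. distr M (borel_of \<T>) (scaled_path n X))"
    unfolding J1_topology_def J2_topology_def M1_topology_def M2_topology_def by blast
qed

end
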